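(* Let $\Phi=(A;\{E_i\}_{i=0}^d;A^*;\{E^*_i\}_{i=0}^d)$ be a Leonard system in $\mathcal{A}$ with parameter array $(\{\theta_i\}_{i=0}^d;\{\theta^*_i\}_{i=0}^d;\{\varphi_i\}_{i=1}^d;\{\phi_i\}_{i=1}^d)$, and let $\xi_0\in E_0V$, $\xi_d\in E_dV$, $\xi^*_0\in E^*_0V$, $\xi^*_d\in E^*_dV$ be nonzero vectors. Then (i) and (ii) hold. (i) Let $\{X_i\}_{i=0}^d$ denote one of the sequences $\{E_i\}_{i=0}^d$, $\{E_{d-i}\}_{i=0}^d$, $\{\tau_i(A)\}_{i=0}^d$, $\{\tau_{d-i}(A)\}_{i=0}^d$, $\{\eta_i(A)\}_{i=0}^d$, $\{\eta_{d-i}(A)\}_{i=0}^d$. Then for $0\le i\le d$, \begin{align*} \frac{1}{\mathrm{tr}(E_0E^*_0)}\sum_{r=0}^d\frac{X_rE^*_0E_0\tau^*_r(A^* )}{\varphi_1\varphi_2\cdots\varphi_r}\cdot\tau_i(A)\xi^*_0 &= X_i\xi^*_0,\\ \frac{\tau^*_d(\theta^*_d)}{\varphi}\frac{\langle\xi_0,\xi^*_d\rangle}{\langle\xi_0,\xi^*_0\rangle}\sum_{r=0}^dX_rE^*_d\eta_{d-r}(A)\cdot\tau_i(A)\xi^*_0 &= X_i\xi^*_d,\\ \frac{1}{\mathrm{tr}(E_0E^*_0)}\sum_{r=0}^d\frac{X_{d-r}E^*_0E_0\tau^*_r(A^* )}{\varphi_1\varphi_2\cdots\varphi_r}\cdot\tau_{d-i}(A)\xi^*_0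 &= X_i\xi^*_0,\\ \frac{\tau^*_d(\theta^*_d)}{\varphi}\frac{\langle\xi_0,\xi^*_d\rangle}{\langle\xi_0,\xi^*_0\rangle}\sum_{r=0}^dX_{d-r}E^*_d\eta_{d-r}(A)\cdot\tau_{d-i}(A)\xi^*_0 &= X_i\xi^*_d. \end{align*} (ii) Let $\{X_i\}_{i=0}^d$ denote one of the sequences $\{E^*_i\}_{i=0}^d$, $\{E^*_{d-i}\}_{i=0}^d$, $\{\tau^*_i(A^* )\}_{i=0}^d$, $\{\tau^*_{d-i}(A^* )\}_{i=0}^d$, $\{\eta^*_i(A^* )\}_{i=0}^d$, $\{\eta^*_{d-i}(A^* )\}_{i=0}^d$. Then for $0\le i\le d$, \begin{align*} \frac{\langle\xi_0,\xi_0\rangle}{\langle\xi_0,\xi^*_0\rangle}\sum_{r=0}^d\frac{X_rE_0\tau^*_r(A^* )}{\varphi_1\varphi_2\cdots\varphi_r}\cdot\tau_i(A)\xi^*_0 &= X_i\xi_0,\\ \frac{\tau^*_d(\theta^*_d)}{\phi}\frac{\langle\xi_d,\xi_d\rangle}{\langle\xi_d,\xi^*_0\rangle}\sum_{r=0}^dX_rE_dE^*_d\eta_{d-r}(A)\cdot\tau_i(A)\xi^*_0 &= X_i\xi_d,\\ \frac{\langle\xi_0,\xi_0\rangle}{\langle\xi_0,\xi^*_0\rangle}\sum_{r=0}^d\frac{X_{d-r}E_0\tau^*_r(A^* )}{\varphi_1\varphi_2\cdots\varphi_r}\cdot\tau_{d-i}(A)\xi^*_0 &= X_i\xi_0,\\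 \frac{\tau^*_d(\theta^*_d)}{\phi}\frac{\langle\xi_d,\xi_d\rangle}{\langle\xi_d,\xi^*_0\rangle}\sum_{r=0}^dX_{d-r}E_dE^*_d\eta_{d-r}(A)\cdot\tau_{d-i}(A)\xi^*_0 &= X_i\xi_d. \end{align*}
   Context: Let $\mathbb{K}$ be a field, $d\ge 0$ an integer, $\mathcal{A}$ a $\mathbb{K}$-algebra isomorphic to the algebra $\mathrm{Mat}_{d+1}(\mathbb{K})$ of all $(d+1)\times(d+1)$ matrices over $\mathbb{K}$, $I$ its identity, and $V$ an irreducible left $\mathcal{A}$-module (so $\dim V=d+1$). For $X\in\mathcal{A}$, $\mathrm{tr}(X)$ is the trace of $X$ (equivalently of its action on $V$). Leonard system. An element of $\mathcal{A}$ is multiplicity-free if it has $d+1$ mutually distinct eigenvalues in $\mathbb{K}$. If $A$ is multiplicity-free with eigenvalues $\theta_0,\dots,\theta_d$, the primitive idempotent of $A$ associated with $\theta_i$ is $E_i=\prod_{0\le j\le d,\,j\ne i}\frac{A-\theta_jI}{\theta_i-\theta_j}$ (the projection onto the one-dimensional $\theta_i$-eigenspace $E_iV$). A Leonard system in $\mathcal{A}$ is a sequence $\Phi=(A;\{E_i\}_{i=0}^d;A^*;\{E^*_i\}_{i=0}^d)$ such that: (i) each of $A,A^*$ is a multiplicity-free element of $\mathcal{A}$ ($A^*$ is just another element; no adjoint is meant); (ii) $\{E_i\}_{i=0}^d$ is an ordering of the primitive idempotents of $A$; (iii) $\{E^*_i\}_{i=0}^d$ is an ordering of the primitive idempotents of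 $A^*$; (iv) for $0\le i,j\le d$, $E_iA^*E_j=0$ if $|i-j|>1$ and $E_iA^*E_j\ne0$ if $|i-j|=1$; (v) for $0\le i,j\le d$, $E^*_iAE^*_j=0$ if $|i-j|>1$ and $E^*_iAE^*_j\neq0$ if $|i-j|=1$. Parameter array. $\theta_i$ (resp. $\theta^*_i$) is the eigenvalue of $A$ (resp. $A^*$) associated with $E_i$ (resp. $E^*_i$). For $0\le i\le d$ define polynomials $\tau_i=(\lambda-\theta_0)(\lambda-\theta_1)\cdots(\lambda-\theta_{i-1})$, $\eta_i=(\lambda-\theta_d)(\lambda-\theta_{d-1})\cdots(\lambda-\theta_{d-i+1})$, $\tau^*_i=(\lambda-\theta^*_0)(\lambda-\theta^*_1)\cdots(\lambda-\theta^*_{i-1})$, $\eta^*_i=(\lambda-\theta^*_d)(\lambda-\theta^*_{d-1})\cdots(\lambda-\theta^*_{d-i+1})$. For $1\le i\le d$ define $\varphi_i=(\theta^*_0-\theta^*_i)\frac{\mathrm{tr}(\tau_i(A)E^*_0)}{\mathrm{tr}(\tau_{i-1}(A)E^*_0)}$ and $\phi_i=(\theta^*_0-\theta^*_i)\frac{\mathrm{tr}(\eta_i(A)E^*_0)}{\mathrm{tr}(\eta_{i-1}(A)E^*_0)}$; the denominators, and all $\varphi_i,\phi_i$, are known to be nonzero. The parameter array of $\Phi$ is $(\{\theta_i\}_{i=0}^d;\{\theta^*_i\}_{i=0}^d;\{\varphi_i\}_{i=1}^d;\{\phi_i\}_{i=1}^d)$. Abbreviate $\varphi=\varphi_1\varphi_2\cdots\varphi_d$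 and $\phi=\phi_1\phi_2\cdots\phi_d$. Empty products are $1$. Bilinear form. There is a unique antiautomorphism $\dagger$ of $\mathcal{A}$ ($\mathbb{K}$-linear bijection with $(XY)^\dagger=Y^\dagger X^\dagger$) with $A^\dagger=A$ and $A^{*\dagger}=A^*$. $\langle\,,\rangle$ denotes a fixed nonzero bilinear form on $V$ with $\langle Xu,v\rangle=\langle u,X^\dagger v\rangle$ for all $X\in\mathcal{A}$, $u,v\in V$; it exists, is unique up to a nonzero scalar factor, and is nondegenerate and symmetric. All scalars appearing in denominators (traces and inner products) are known to be nonzero. The notation $T\cdot v$ means the element $T\in\mathcal{A}$ (including the scalar prefactor and the whole sum) applied to $v\in V$. *)

theory Defs
  imports "Jordan_Normal_Form.Char_Poly"
begin

text \<open>The algebra is the whole type \<open>'a\<close>, with scalar multiplication \<open>scaleA\<close> over the field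
  \<open>'k\<close>; \<open>iota\<close> is an algebra isomorphism onto the \<open>(d+1) \<times> (d+1)\<close> matrices. Trace and eigenvalues
  of an algebra element are those of its image under \<open>iota\<close>; they do not depend on the choice of
  \<open>iota\<close>, since all automorphisms of the matrix algebra are inner.\<close>

locale matrix_algebra = vector_space scaleA
  for scaleA :: "'k::field \<Rightarrow> 'a::ring_1 \<Rightarrow> 'a" +
  fixes d :: nat
    and iota :: "'a \<Rightarrow> 'k mat"
  assumes scale_mult_left: "scaleA c X * Y = scaleA c (X * Y)"
    and scale_mult_right: "X * scaleA c Y = scaleA c (X * Y)"
    and iota_bij: "bij_betw iota UNIV (carrier_mat (Suc d) (Suc d))"
    and iota_add: "iota (X + Y) = iota X + iota Y"
    and iota_scale: "iota (scaleA c X) = c \<cdot>\<^sub>m iota X"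
    and iota_mult: "iota (X * Y) = iota X * iota Y"
    and iota_one: "iota 1 = 1\<^sub>m (Suc d)"

locale irreducible_module = matrix_algebra scaleA d iota + V: vector_space scaleV
  for scaleA :: "'k::field \<Rightarrow> 'a::ring_1 \<Rightarrow> 'a"
    and d :: nat
    and iota :: "'a \<Rightarrow> 'k mat"
    and scaleV :: "'k \<Rightarrow> 'v::ab_group_add \<Rightarrow> 'v" +
  fixes act :: "'a \<Rightarrow> 'v \<Rightarrow> 'v"
  assumes act_add_left: "act (X + Y) v = act X v + act Y v"
    and act_add_right: "act X (u + v) = act X u + act X v"
    and act_scale_left: "act (scaleA c X) v = scaleV c (act X v)"
    and act_scale_right: "act X (scaleV c v) = scaleV c (act X v)"
    and act_one: "act 1 v = v"
    and act_mult: "act (X * Y) v = act X (act Y v)"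
    and nontrivial: "\<exists>v::'v. v \<noteq> 0"
    and irreducible: "V.subspace W \<Longrightarrow> (\<And>X w. w \<in> W \<Longrightarrow> act X w \<in> W) \<Longrightarrow> W = {0} \<or> W = UNIV"

definition tr :: "nat \<Rightarrow> ('a \<Rightarrow> 'k::field mat) \<Rightarrow> 'a \<Rightarrow> 'k" where
  "tr d iota X = (\<Sum>i\<le>d. iota X $$ (i, i))"

definition eigenvalues :: "('a \<Rightarrow> 'k::field mat) \<Rightarrow> 'a \<Rightarrow> 'k set" where
  "eigenvalues iota X = {t. eigenvalue (iota X) t}"

definition multiplicity_free :: "nat \<Rightarrow> ('a \<Rightarrow> 'k::field mat) \<Rightarrow> 'a \<Rightarrow> bool" where
  "multiplicity_free d iota X \<longleftrightarrow> card (eigenvalues iota X) = d + 1"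

text \<open>The factors commute, so the order chosen for the list product is immaterial.\<close>

definition primitive_idempotent ::
    "('k::field \<Rightarrow> 'a::ring_1 \<Rightarrow> 'a) \<Rightarrow> nat \<Rightarrow> 'a \<Rightarrow> (nat \<Rightarrow> 'k) \<Rightarrow> nat \<Rightarrow> 'a" where
  "primitive_idempotent scaleA d X \<theta> i =
     prod_list (map (\<lambda>j. scaleA (1 / (\<theta> i - \<theta> j)) (X - scaleA (\<theta> j) 1))
                    (filter (\<lambda>j. j \<noteq> i) [0..<Suc d]))"

text \<open>\<open>\<theta> 0, \<dots>, \<theta> d\<close> lists the eigenvalues of \<open>X\<close>, and \<open>E i\<close> is the primitive idempotent associated
  with \<open>\<theta> i\<close>. Here and below, values of sequences at indices beyond \<open>d\<close> are irrelevant.\<close>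

definition idempotent_ordering ::
    "('k::field \<Rightarrow> 'a::ring_1 \<Rightarrow> 'a) \<Rightarrow> nat \<Rightarrow> ('a \<Rightarrow> 'k mat) \<Rightarrow> 'a \<Rightarrow> (nat \<Rightarrow> 'k) \<Rightarrow> (nat \<Rightarrow> 'a) \<Rightarrow> bool"
  where
  "idempotent_ordering scaleA d iota X \<theta> E \<longleftrightarrow>
     bij_betw \<theta> {..d} (eigenvalues iota X) \<and>
     (\<forall>i\<le>d. E i = primitive_idempotent scaleA d X \<theta> i)"

definition leonard_system ::
    "('k::field \<Rightarrow> 'a::ring_1 \<Rightarrow> 'a) \<Rightarrow> nat \<Rightarrow> ('a \<Rightarrow> 'k mat) \<Rightarrow>
     'a \<Rightarrow> (nat \<Rightarrow> 'a) \<Rightarrow> 'a \<Rightarrow> (nat \<Rightarrow> 'a) \<Rightarrow> bool" where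
  "leonard_system scaleA d iota A E As Es \<longleftrightarrow>
     multiplicity_free d iota A \<and> multiplicity_free d iota As \<and>
     (\<exists>\<theta>. idempotent_ordering scaleA d iota A \<theta> E) \<and>
     (\<exists>\<theta>s. idempotent_ordering scaleA d iota As \<theta>s Es) \<and>
     (\<forall>i\<le>d. \<forall>j\<le>d.
        (\<bar>int i - int j\<bar> > 1 \<longrightarrow> E i * As * E j = 0) \<and>
        (\<bar>int i - int j\<bar> = 1 \<longrightarrow> E i * As * E j \<noteq> 0)) \<and>
     (\<forall>i\<le>d. \<forall>j\<le>d.
        (\<bar>int i - int j\<bar> > 1 \<longrightarrow> Es i * A * Es j = 0) \<and>
        (\<bar>int i - int j\<bar> = 1 \<longrightarrow> Es i * A * Es j \<noteq> 0))"

definition poly_at :: "('k::field \<Rightarrow> 'a::ring_1 \<Rightarrow> 'a) \<Rightarrow> 'k poly \<Rightarrow> 'a \<Rightarrow> 'a" where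
  "poly_at scaleA p X = (\<Sum>n\<le>degree p. scaleA (coeff p n) (X ^ n))"

definition tau :: "(nat \<Rightarrow> 'k::field) \<Rightarrow> nat \<Rightarrow> 'k poly" where
  "tau \<theta> i = (\<Prod>j<i. [:- \<theta> j, 1:])"

definition eta :: "nat \<Rightarrow> (nat \<Rightarrow> 'k::field) \<Rightarrow> nat \<Rightarrow> 'k poly" where
  "eta d \<theta> i = (\<Prod>j<i. [:- \<theta> (d - j), 1:])"

text \<open>\<open>vphi\<close> and \<open>phi\<close> are the first and second split sequences (indices \<open>1, \<dots>, d\<close>), usually written with
  the two letter forms of phi. A suffix \<open>s\<close> stands for the star of the dual object: \<open>As\<close> is just another
  algebra element, not an adjoint.\<close>

definition parameter_array ::
    "('k::field \<Rightarrow> 'a::ring_1 \<Rightarrow> 'a) \<Rightarrow> nat \<Rightarrow> ('a \<Rightarrow> 'k mat) \<Rightarrow>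
     'a \<Rightarrow> (nat \<Rightarrow> 'a) \<Rightarrow> 'a \<Rightarrow> (nat \<Rightarrow> 'a) \<Rightarrow>
     (nat \<Rightarrow> 'k) \<Rightarrow> (nat \<Rightarrow> 'k) \<Rightarrow> (nat \<Rightarrow> 'k) \<Rightarrow> (nat \<Rightarrow> 'k) \<Rightarrow> bool" where
  "parameter_array scaleA d iota A E As Es \<theta> \<theta>s vphi phi \<longleftrightarrow>
     idempotent_ordering scaleA d iota A \<theta> E \<and>
     idempotent_ordering scaleA d iota As \<theta>s Es \<and>
     (\<forall>i\<in>{1..d}. vphi i = (\<theta>s 0 - \<theta>s i) *
        (tr d iota (poly_at scaleA (tau \<theta> i) A * Es 0) /
         tr d iota (poly_at scaleA (tau \<theta> (i - 1)) A * Es 0))) \<and>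
     (\<forall>i\<in>{1..d}. phi i = (\<theta>s 0 - \<theta>s i) *
        (tr d iota (poly_at scaleA (eta d \<theta> i) A * Es 0) /
         tr d iota (poly_at scaleA (eta d \<theta> (i - 1)) A * Es 0)))"

definition antiautomorphism :: "('k::field \<Rightarrow> 'a::ring_1 \<Rightarrow> 'a) \<Rightarrow> ('a \<Rightarrow> 'a) \<Rightarrow> bool" where
  "antiautomorphism scaleA dag \<longleftrightarrow>
     Vector_Spaces.linear scaleA scaleA dag \<and> bij dag \<and> (\<forall>X Y. dag (X * Y) = dag Y * dag X)"

definition bilinear_form :: "('k::field \<Rightarrow> 'v::ab_group_add \<Rightarrow> 'v) \<Rightarrow> ('v \<Rightarrow> 'v \<Rightarrow> 'k) \<Rightarrow> bool" where
  "bilinear_form scaleV form \<longleftrightarrow>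
     (\<forall>u. Vector_Spaces.linear scaleV (*) (\<lambda>v. form u v)) \<and>
     (\<forall>v. Vector_Spaces.linear scaleV (*) (\<lambda>u. form u v))"

end

theory Submission
  imports Defs
begin

text \<open>Write \<open>\<xi>\<close> for \<open>\<xi>s0\<close> and \<open>u i = \<tau>\<^sub>i(A) \<xi>\<close>. Each identity says that a sum of operators \<open>X r * Y r\<close> maps \<open>u i\<close> to a
  vector of the form \<open>X i \<zeta>\<close>. Since the \<open>X r\<close> occur only as left factors, it is enough that the \<open>Y r\<close> are dual to the
  \<open>u i\<close>: \<open>Y r\<close> kills \<open>u i\<close> for \<open>r \<noteq> i\<close> and \<open>Y i\<close> sends \<open>u i\<close> to a multiple of \<open>\<zeta>\<close> that does not depend on \<open>i\<close>. The six
  choices of \<open>X\<close> are then treated at once, and the sums with \<open>X (d - r)\<close> are the same identities for the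
  reversed sequence.

  Two families of dual operators occur. For \<open>Es d * \<eta>\<^sub>d\<^sub>-\<^sub>r(A)\<close> duality is a matter of degrees and roots
  (\<open>Es_d_eta_u\<close>): on \<open>\<xi>\<close> the operator \<open>Es d\<close> sees only polynomials in \<open>A\<close> of degree at least \<open>d\<close>, because \<open>A\<close> is
  tridiagonal with respect to the \<open>Es i\<close>. For \<open>E 0 * \<tau>\<^sup>*\<^sub>r(As)\<close> it rests on the split decomposition (\<open>As_u\<close>):
  \<open>As\<close> maps \<open>u i\<close> to \<open>\<theta>s i u i + vphi i u (i - 1)\<close>. Since \<open>E 0\<close> kills all \<open>u i\<close> but \<open>u 0\<close>, the only way for
  \<open>\<tau>\<^sup>*\<^sub>r(As)\<close> to contribute is to lower \<open>u r\<close> to \<open>u 0\<close> in \<open>r\<close> steps, with coefficient \<open>vphi 1 \<cdots> vphi r\<close>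
  (\<open>E_0_taus_u\<close>).

  The split decomposition holds because \<open>E\<^sub>m V + \<dots> + E\<^sub>d V\<close> and \<open>Es\<^sub>0 V + \<dots> + Es\<^sub>m\<^sub>-\<^sub>1 V\<close> intersect trivially
  (\<open>eq_0_if_split_component\<close>). The trace formula for its coefficients follows from \<open>Es 0 * Y * Es 0 = tr (Y * Es 0) Es 0\<close>,
  a property of rank-one idempotents that is verified in an eigenbasis
  (\<open>spectral_resolution_if_idempotent_ordering\<close>). It remains to match normalizations. The invariant form
  makes \<open>E i\<close> the orthogonal projection onto a line spanned by a vector that is not isotropic (\<open>projection\<close>),
  and since \<open>\<tau>\<^sup>*\<^sub>d(As)\<close> is a multiple of \<open>Es d\<close>, duality for \<open>r = i = d\<close> relates \<open>E 0 * Es d * A ^ d\<close> to \<open>E 0\<close> on \<open>\<xi>\<close>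
  (\<open>E_0_Es_d_power\<close>). The identities with \<open>E d\<close> and \<open>phi\<close> use the same fact for the Leonard system in which the
  order of the \<open>E i\<close> is reversed.\<close>

section \<open>Spectral resolutions in the matrix algebra\<close>

text \<open>The eigenvalues and primitive idempotents of the distinguished elements become matrices of this shape in
  an eigenbasis.\<close>

definition diagonal :: "nat \<Rightarrow> (nat \<Rightarrow> 'k::field) \<Rightarrow> 'k mat" where
  "diagonal n f = mat n n (\<lambda>(a, b). if a = b then f a else 0)"

lemma diagonal_carrier [simp]: "diagonal n f \<in> carrier_mat n n"
  by (simp add: diagonal_def)

lemma diagonal_index [simp]:
  "a < n \<Longrightarrow> b < n \<Longrightarrow> diagonal n f $$ (a, b) = (if a = b then f a else 0)"
  by (simp add: diagonal_def)

lemma diagonal_cong: "(\<And>a. a < n \<Longrightarrow> f a = g a) \<Longrightarrow> diagonal n f = diagonal n g"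
  by (auto simp: diagonal_def)

lemma mult_diagonal_index:
  assumes "M \<in> carrier_mat n n" "a < n" "b < n"
  shows "(M * diagonal n f) $$ (a, b) = M $$ (a, b) * f b"
proof -
  have "(M * diagonal n f) $$ (a, b) = (\<Sum>c<n. M $$ (a, c) * (if c = b then f c else 0))"
    using assms by (auto simp: diagonal_def scalar_prod_def lessThan_atLeast0 intro!: sum.cong)
  also have "\<dots> = (\<Sum>c<n. if c = b then M $$ (a, c) * f c else 0)"
    by (intro sum.cong) auto
  also have "\<dots> = M $$ (a, b) * f b"
    using assms by simp
  finally show ?thesis .
qed

lemma diagonal_mult_index:
  assumes "M \<in> carrier_mat n n" "a < n" "b < n"
  shows "(diagonal n f * M) $$ (a, b) = f a * M $$ (a, b)"
proof -
  have "(diagonal n f * M) $$ (a, b) = (\<Sum>c<n. (if a = c then f a else 0) * M $$ (c, b))"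
    using assms by (auto simp: diagonal_def scalar_prod_def lessThan_atLeast0 intro!: sum.cong)
  also have "\<dots> = (\<Sum>c<n. if a = c then f a * M $$ (c, b) else 0)"
    by (intro sum.cong) auto
  also have "\<dots> = f a * M $$ (a, b)"
    using assms by simp
  finally show ?thesis .
qed

lemma diagonal_mult: "diagonal n f * diagonal n g = diagonal n (\<lambda>a. f a * g a)"
proof (rule eq_matI)
  fix a b
  assume "a < dim_row (diagonal n (\<lambda>a. f a * g a))" "b < dim_col (diagonal n (\<lambda>a. f a * g a))"
  then have "a < n" "b < n" by (simp_all add: diagonal_def)
  then show "(diagonal n f * diagonal n g) $$ (a, b) = diagonal n (\<lambda>a. f a * g a) $$ (a, b)"
    by (simp add: mult_diagonal_index)
qed (simp_all add: diagonal_def)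

lemma diagonal_one: "1\<^sub>m n = diagonal n (\<lambda>_. 1)"
  by (auto simp: diagonal_def one_mat_def)

lemma trace_mult_commute:
  fixes M N :: "'k::field mat"
  assumes "M \<in> carrier_mat n n" "N \<in> carrier_mat n n"
  shows "(\<Sum>i<n. (M * N) $$ (i, i)) = (\<Sum>i<n. (N * M) $$ (i, i))"
proof -
  have "(\<Sum>i<n. (M * N) $$ (i, i)) = (\<Sum>i<n. \<Sum>j<n. M $$ (i, j) * N $$ (j, i))"
    using assms by (auto simp: scalar_prod_def lessThan_atLeast0 intro!: sum.cong)
  also have "\<dots> = (\<Sum>j<n. \<Sum>i<n. N $$ (j, i) * M $$ (i, j))"
    by (subst sum.swap) (simp add: mult.commute)
  also have "\<dots> = (\<Sum>j<n. (N * M) $$ (j, j))"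
    using assms by (auto simp: scalar_prod_def lessThan_atLeast0 intro!: sum.cong)
  finally show ?thesis .
qed

context matrix_algebra
begin

lemma iota_carrier [simp]: "iota X \<in> carrier_mat (Suc d) (Suc d)"
  using iota_bij by (auto simp: bij_betw_def)

lemma iota_dim [simp]: "dim_row (iota X) = Suc d" "dim_col (iota X) = Suc d"
  using iota_carrier[of X] by (auto simp del: iota_carrier)

lemma iota_inject: "iota X = iota Y \<longleftrightarrow> X = Y"
  using iota_bij by (auto simp: bij_betw_def inj_on_def)

lemmas assoc_square =
  assoc_mult_mat[where n\<^sub>1 = "Suc d" and n\<^sub>2 = "Suc d" and n\<^sub>3 = "Suc d" and n\<^sub>4 = "Suc d"]
  mult_carrier_mat[where n = "Suc d" and nr = "Suc d" and nc = "Suc d"]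

lemma iota_zero: "iota 0 = 0\<^sub>m (Suc d) (Suc d)"
proof -
  have "iota 0 = 0 \<cdot>\<^sub>m iota 0" using iota_scale[of 0 0] by simp
  also have "\<dots> = 0\<^sub>m (Suc d) (Suc d)" by (intro eq_matI) simp_all
  finally show ?thesis .
qed

lemma iota_diff: "iota (X - Y) = iota X - iota Y"
proof -
  have "iota (X - Y) = iota (X + scaleA (-1) Y)" by simp
  also have "\<dots> = iota X - iota Y"
    unfolding iota_add iota_scale by (intro eq_matI) (simp_all)
  finally show ?thesis .
qed

lemma iota_sum_index:
  assumes "finite B" "a \<le> d" "b \<le> d"
  shows "iota (\<Sum>x\<in>B. f x) $$ (a, b) = (\<Sum>x\<in>B. iota (f x) $$ (a, b))"
  using assms(1) assms(2,3) by (induction rule: finite_induct) (simp_all add: iota_zero iota_add)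

text \<open>Multiplying by a matrix unit and taking the trace reads off any chosen entry, in particular a nonzero one.\<close>

lemma tr_nondegenerate:
  assumes "Y \<noteq> 0"
  obtains X where "tr d iota (X * Y) \<noteq> 0"
proof -
  have "iota Y \<noteq> 0\<^sub>m (Suc d) (Suc d)"
    using assms by (simp flip: iota_zero add: iota_inject)
  then obtain a b where ab: "a < Suc d" "b < Suc d" "iota Y $$ (a, b) \<noteq> 0"
    by (metis eq_matI index_zero_mat iota_dim)
  define M :: "'k mat" where
    "M = mat (Suc d) (Suc d) (\<lambda>(x, y). if x = b \<and> y = a then 1 else 0)"
  have "M \<in> iota ` UNIV"
    using iota_bij by (simp add: bij_betw_def M_def)
  then obtain X where X: "iota X = M" by auto
  have "tr d iota (X * Y) = (\<Sum>i\<le>d. \<Sum>j\<le>d. M $$ (i, j) * iota Y $$ (j, i))"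
    unfolding tr_def iota_mult X
    by (intro sum.cong)
      (auto simp: M_def scalar_prod_def simp flip: lessThan_Suc_atMost lessThan_atLeast0
        intro!: sum.cong)
  also have "\<dots> = (\<Sum>i\<le>d. \<Sum>j\<le>d. if i = b \<and> j = a then iota Y $$ (a, b) else 0)"
    by (intro sum.cong refl) (auto simp: M_def)
  also have "\<dots> = (\<Sum>i\<le>d. if i = b then \<Sum>j\<le>d. if j = a then iota Y $$ (a, b) else 0 else 0)"
    by (intro sum.cong refl) auto
  also have "\<dots> = iota Y $$ (a, b)"
    using ab by (simp add: sum.delta')
  finally show thesis
    using ab that by metis
qed

text \<open>A change of basis gives another isomorphism onto the matrices with the same trace. This allows
  trace identities to be checked in a basis in which the element at hand is diagonal.\<close>

lemma conjugate:
  assumes S: "S \<in> carrier_mat (Suc d) (Suc d)" and T: "T \<in> carrier_mat (Suc d) (Suc d)"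
    and ST: "S * T = 1\<^sub>m (Suc d)" and TS: "T * S = 1\<^sub>m (Suc d)"
  shows "matrix_algebra scaleA d (\<lambda>X. T * iota X * S)"
    and "tr d (\<lambda>X. T * iota X * S) X = tr d iota X"
proof -
  let ?C = "carrier_mat (Suc d) (Suc d) :: 'k mat set"
  have cancel: "S * (T * M * S) * T = M" "T * (S * M * T) * S = M" if M: "M \<in> ?C" for M
  proof -
    have "S * (T * M * S) * T = (S * T) * M * (S * T)"
      using S T M by (simp add: assoc_square)
    then show "S * (T * M * S) * T = M"
      using M by (simp add: ST)
    have "T * (S * M * T) * S = (T * S) * M * (T * S)"
      using S T M by (simp add: assoc_square)
    then show "T * (S * M * T) * S = M"
      using M by (simp add: TS)
  qed
  have "bij_betw (\<lambda>M. T * M * S) ?C ?C"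
    by (rule bij_betwI[where g = "\<lambda>M. S * M * T"]) (use S T cancel in auto)
  then have bij: "bij_betw (\<lambda>X. T * iota X * S) UNIV ?C"
    using bij_betw_trans[OF iota_bij] by (simp add: comp_def)
  show "matrix_algebra scaleA d (\<lambda>X. T * iota X * S)"
  proof (unfold_locales, goal_cases)
    case 1 show ?case by (rule scale_mult_left)
  next
    case 2 show ?case by (rule scale_mult_right)
  next
    case 3 show ?case by (rule bij)
  next
    case (4 X Y)
    have "T * (iota X + iota Y) * S = (T * iota X + T * iota Y) * S"
      using T by (subst mult_add_distrib_mat) auto
    also have "\<dots> = T * iota X * S + T * iota Y * S"
      by (rule add_mult_distrib_mat) (use S T in auto)
    finally show ?case by (simp add: iota_add)
  next
    case (5 c X)
    have "T * (c \<cdot>\<^sub>m iota X) * S = (c \<cdot>\<^sub>m (T * iota X)) * S"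
      using T by (subst mult_smult_distrib) auto
    also have "\<dots> = c \<cdot>\<^sub>m (T * iota X * S)"
      by (rule mult_smult_assoc_mat) (use S T in auto)
    finally show ?case by (simp add: iota_scale)
  next
    case (6 X Y)
    have "T * iota X * S * (T * iota Y * S) = T * iota X * (S * T) * iota Y * S"
      using S T by (simp add: assoc_square)
    also have "\<dots> = T * (iota X * iota Y) * S"
      using S T by (simp add: ST assoc_square)
    finally show ?case by (simp add: iota_mult)
  next
    case 7
    show ?case using T by (simp add: iota_one TS)
  qed
  have "(\<Sum>i<Suc d. (T * (iota X * S)) $$ (i, i)) = (\<Sum>i<Suc d. (iota X * S * T) $$ (i, i))"
    by (rule trace_mult_commute) (use S T in auto)
  moreover have "T * iota X * S = T * (iota X * S)" "iota X * S * T = iota X"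
    using S T by (simp_all add: assoc_square ST)
  ultimately show "tr d (\<lambda>X. T * iota X * S) X = tr d iota X"
    by (simp add: tr_def lessThan_Suc_atMost)
qed

end

text \<open>What is used of the primitive idempotents of a multiplicity-free element. The last condition
  expresses that each \<open>E i\<close> has rank one: it compresses every element to a multiple of itself, and the
  multiple is a trace, which is how the traces in the split sequences become accessible on the module.\<close>

locale spectral_resolution = matrix_algebra scaleA d iota
  for scaleA :: "'k::field \<Rightarrow> 'a::ring_1 \<Rightarrow> 'a" and d :: nat and iota :: "'a \<Rightarrow> 'k mat" +
  fixes X :: 'a and \<theta> :: "nat \<Rightarrow> 'k" and E :: "nat \<Rightarrow> 'a"
  assumes inj: "inj_on \<theta> {..d}"
    and orth: "\<lbrakk>i \<le> d; j \<le> d\<rbrakk> \<Longrightarrow> E i * E j = (if i = j then E i else 0)"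
    and complete: "(\<Sum>i\<le>d. E i) = 1"
    and eigen: "i \<le> d \<Longrightarrow> X * E i = scaleA (\<theta> i) (E i)"
    and rank_one: "i \<le> d \<Longrightarrow> E i * Y * E i = scaleA (tr d iota (Y * E i)) (E i)"

context matrix_algebra
begin

text \<open>The columns of \<open>S\<close> are eigenvectors, so a product of factors \<open>X - \<theta> j\<close> scales each column. The linear
  independence of the columns is deduced from this in \<open>diagonalization\<close>.\<close>

lemma iota_factors_mult_eigenvectors:
  assumes S: "S \<in> carrier_mat (Suc d) (Suc d)"
    and XS: "iota X * S = S * diagonal (Suc d) \<theta>"
  shows "iota (prod_list (map (\<lambda>j. scaleA (c j) (X - scaleA (\<theta> j) 1)) js)) * S
       = S * diagonal (Suc d) (\<lambda>a. \<Prod>j\<leftarrow>js. c j * (\<theta> a - \<theta> j))"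
proof (induction js)
  case Nil
  then show ?case using S by (simp add: iota_one flip: diagonal_one)
next
  case (Cons j js)
  let ?P = "prod_list (map (\<lambda>j. scaleA (c j) (X - scaleA (\<theta> j) 1)) js)"
  let ?F = "scaleA (c j) (X - scaleA (\<theta> j) 1)"
  let ?f = "\<lambda>a. c j * (\<theta> a - \<theta> j)" and ?g = "\<lambda>a. \<Prod>j\<leftarrow>js. c j * (\<theta> a - \<theta> j)"
  have F: "iota ?F * S = S * diagonal (Suc d) ?f"
  proof -
    have "iota ?F * S = (c j \<cdot>\<^sub>m (iota X - \<theta> j \<cdot>\<^sub>m 1\<^sub>m (Suc d))) * S"
      by (simp add: iota_scale iota_diff iota_one)
    also have "\<dots> = c j \<cdot>\<^sub>m (iota X * S - \<theta> j \<cdot>\<^sub>m S)"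
      using S by (subst mult_smult_assoc_mat[where n = "Suc d"])
        (auto simp: minus_mult_distrib_mat[where n = "Suc d" and nr = "Suc d"]
           mult_smult_assoc_mat[where n = "Suc d" and nr = "Suc d"])
    also have "\<dots> = S * diagonal (Suc d) ?f"
      unfolding XS using S
      by (intro eq_matI)
        (simp_all add: mult_diagonal_index diagonal_def[THEN arg_cong, of dim_col] algebra_simps
          del: index_mult_mat(1))
    finally show ?thesis .
  qed
  have "iota (?F * ?P) * S = iota ?F * (iota ?P * S)"
    using S by (simp add: iota_mult assoc_square)
  also have "\<dots> = (iota ?F * S) * diagonal (Suc d) ?g"
    using S unfolding Cons.IH
    by (simp add: assoc_square)
  also have "\<dots> = S * (diagonal (Suc d) ?f * diagonal (Suc d) ?g)"
    using S unfolding F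
    by (simp add: assoc_square)
  finally show ?case by (simp add: diagonal_mult)
qed

lemma iota_primitive_idempotent_mult_eigenvectors:
  assumes "S \<in> carrier_mat (Suc d) (Suc d)" and "iota X * S = S * diagonal (Suc d) \<theta>"
    and inj: "inj_on \<theta> {..d}" and i: "i \<le> d"
  shows "iota (primitive_idempotent scaleA d X \<theta> i) * S
       = S * diagonal (Suc d) (\<lambda>a. if a = i then 1 else 0)"
proof -
  let ?js = "filter (\<lambda>j. j \<noteq> i) [0..<Suc d]"
  have "(\<Prod>j\<leftarrow>?js. 1 / (\<theta> i - \<theta> j) * (\<theta> a - \<theta> j)) = (if a = i then 1 else 0)"
    if a: "a < Suc d" for a
  proof (cases "a = i")
    case True
    have "map (\<lambda>j. 1 / (\<theta> i - \<theta> j) * (\<theta> i - \<theta> j)) ?js = map (\<lambda>_. 1) ?js"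
      using inj i by (intro map_cong refl) (auto simp: inj_on_def less_Suc_eq_le simp del: upt_Suc)
    moreover have "prod_list (map (\<lambda>_. 1 :: 'k) xs) = 1" for xs :: "nat list"
      by (induction xs) auto
    ultimately show ?thesis using True by metis
  next
    case False
    then have "a \<in> set ?js" using a by auto
    then have "0 \<in> set (map (\<lambda>j. 1 / (\<theta> i - \<theta> j) * (\<theta> a - \<theta> j)) ?js)"
      by force
    then show ?thesis using False by (metis prod_list_zero_iff)
  qed
  then show ?thesis
    unfolding primitive_idempotent_def
    by (subst iota_factors_mult_eigenvectors[OF assms(1,2)]) (auto intro!: diagonal_cong arg_cong2[where f = "(*)"])
qed

text \<open>Choose an eigenvector for each eigenvalue as a column of \<open>S\<close>. A linear relation between the columns,
  hit with the primitive idempotent for \<open>\<theta> i\<close>, retains only its \<open>i\<close>-th term, so all coefficients vanish.\<close>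

lemma diagonalization:
  assumes bij: "bij_betw \<theta> {..d} (eigenvalues iota X)"
  obtains S T where "S \<in> carrier_mat (Suc d) (Suc d)" "T \<in> carrier_mat (Suc d) (Suc d)"
    "S * T = 1\<^sub>m (Suc d)" "T * S = 1\<^sub>m (Suc d)" "iota X * S = S * diagonal (Suc d) \<theta>"
proof -
  have "\<exists>v. eigenvector (iota X) v (\<theta> i)" if "i \<le> d" for i
    using bij that by (auto simp: bij_betw_def eigenvalues_def eigenvalue_def)
  then obtain v where "\<And>i. i \<le> d \<Longrightarrow> eigenvector (iota X) (v i) (\<theta> i)"
    by metis
  then have v: "v i \<in> carrier_vec (Suc d)" "v i \<noteq> 0\<^sub>v (Suc d)"
    "iota X *\<^sub>v v i = \<theta> i \<cdot>\<^sub>v v i" if "i \<le> d" for i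
    using that by (simp_all add: eigenvector_def)
  define S where "S = mat (Suc d) (Suc d) (\<lambda>(a, b). v b $ a)"
  have S: "S \<in> carrier_mat (Suc d) (Suc d)" by (simp add: S_def)
  have col: "col S b = v b" if "b \<le> d" for b
    using v(1)[OF that] that by (intro eq_vecI) (auto simp: S_def)
  have XS: "iota X * S = S * diagonal (Suc d) \<theta>"
  proof (rule eq_matI)
    fix a b assume "a < dim_row (S * diagonal (Suc d) \<theta>)" "b < dim_col (S * diagonal (Suc d) \<theta>)"
    then have ab: "a \<le> d" "b \<le> d" by (simp_all add: S_def diagonal_def)
    have "(iota X * S) $$ (a, b) = (iota X *\<^sub>v v b) $ a"
      using ab S by (simp add: col)
    also have "\<dots> = S $$ (a, b) * \<theta> b"
      using ab carrier_vecD[OF v(1)[OF ab(2)]] v(3)[OF ab(2)] by (simp add: S_def)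
    finally show "(iota X * S) $$ (a, b) = (S * diagonal (Suc d) \<theta>) $$ (a, b)"
      using ab S by (simp add: mult_diagonal_index del: index_mult_mat(1))
  qed (simp_all add: S_def diagonal_def)
  have "det S \<noteq> 0"
  proof
    assume "det S = 0"
    then obtain w where w: "w \<in> carrier_vec (Suc d)" "w \<noteq> 0\<^sub>v (Suc d)" "S *\<^sub>v w = 0\<^sub>v (Suc d)"
      using det_0_iff_vec_prod_zero_field[OF S] by auto
    then obtain i where i: "i \<le> d" "w $ i \<noteq> 0"
      by (metis carrier_vecD eq_vecI index_zero_vec less_Suc_eq_le)
    let ?D = "diagonal (Suc d) (\<lambda>a. if a = i then 1 else 0)"
    have P: "iota (primitive_idempotent scaleA d X \<theta> i) * S = S * ?D"
      using iota_primitive_idempotent_mult_eigenvectors[OF S XS _ i(1)] bij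
      by (auto simp: bij_betw_def)
    have "S *\<^sub>v (?D *\<^sub>v w) = (S * ?D) *\<^sub>v w"
      by (rule assoc_mult_mat_vec[symmetric]) (use S w in auto)
    also have "\<dots> = iota (primitive_idempotent scaleA d X \<theta> i) *\<^sub>v (S *\<^sub>v w)"
      unfolding P[symmetric] by (rule assoc_mult_mat_vec) (use S w in auto)
    also have "\<dots> = 0\<^sub>v (Suc d)"
      unfolding w(3) by (intro eq_vecI) (simp_all add: scalar_prod_def)
    finally have zero: "S *\<^sub>v (?D *\<^sub>v w) = 0\<^sub>v (Suc d)" .
    have Dw: "(?D *\<^sub>v w) $ b = (if b = i then w $ i else 0)" if b: "b < Suc d" for b
    proof -
      have "(?D *\<^sub>v w) $ b = (\<Sum>c<Suc d. ?D $$ (b, c) * w $ c)"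
        using w b by (auto simp: scalar_prod_def lessThan_atLeast0 diagonal_def intro!: sum.cong)
      also have "\<dots> = (\<Sum>c<Suc d. if c = b then (if b = i then w $ i else 0) else 0)"
        using b by (intro sum.cong) auto
      also have "\<dots> = (if b = i then w $ i else 0)"
        using b by (simp del: sum.lessThan_Suc)
      finally show ?thesis .
    qed
    have "v i = 0\<^sub>v (Suc d)"
    proof (rule eq_vecI)
      fix a assume "a < dim_vec (0\<^sub>v (Suc d) :: 'k vec)"
      then have a: "a < Suc d" by simp
      have "0 = (S *\<^sub>v (?D *\<^sub>v w)) $ a"
        using zero a by simp
      also have "\<dots> = (\<Sum>b<Suc d. S $$ (a, b) * (?D *\<^sub>v w) $ b)"
        using a S w by (auto simp: scalar_prod_def lessThan_atLeast0 diagonal_def intro!: sum.cong)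
      also have "\<dots> = (\<Sum>b<Suc d. if b = i then S $$ (a, i) * w $ i else 0)"
        by (intro sum.cong) (auto simp: Dw)
      also have "\<dots> = S $$ (a, i) * w $ i"
        using i by (simp del: sum.lessThan_Suc)
      finally show "v i $ a = 0\<^sub>v (Suc d) $ a"
        using a i by (simp add: S_def)
    qed (use v i in auto)
    with v(2)[OF i(1)] show False by simp
  qed
  from det_non_zero_imp_unit[OF S this, of "()"] obtain T where
    "T \<in> carrier_mat (Suc d) (Suc d)" "S * T = 1\<^sub>m (Suc d)" "T * S = 1\<^sub>m (Suc d)"
    by (auto simp: Units_def ring_mat_def)
  then show thesis using that S XS by blast
qed

text \<open>For diagonal \<open>X\<close> the idempotents are diagonal matrix units, and compressing \<open>Y\<close> by the \<open>i\<close>-th one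
  isolates the diagonal entry \<open>Y\<^sub>i\<^sub>i\<close>, which is also the trace of \<open>Y * E i\<close>.\<close>

lemma spectral_resolution_of_diagonal:
  assumes X: "iota X = diagonal (Suc d) \<theta>" and inj: "inj_on \<theta> {..d}"
    and E: "\<And>i. i \<le> d \<Longrightarrow> iota (E i) = diagonal (Suc d) (\<lambda>a. if a = i then 1 else 0)"
  shows "spectral_resolution scaleA d iota X \<theta> E"
proof unfold_locales
  show "inj_on \<theta> {..d}" by (rule inj)
next
  fix i j assume ij: "i \<le> d" "j \<le> d"
  have "iota (E i * E j) = iota (if i = j then E i else 0)"
    using ij by (auto simp: iota_mult E diagonal_mult iota_zero intro!: eq_matI)
       (auto simp: diagonal_def)
  then show "E i * E j = (if i = j then E i else 0)" by (simp add: iota_inject)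
next
  have "iota (\<Sum>i\<le>d. E i) = iota 1"
  proof (rule eq_matI)
    fix a b assume "a < dim_row (iota 1)" "b < dim_col (iota 1)"
    then have ab: "a \<le> d" "b \<le> d" by simp_all
    then have "iota (\<Sum>i\<le>d. E i) $$ (a, b) = (\<Sum>i\<le>d. if i = a then (if a = b then 1 else 0) else 0)"
      unfolding iota_sum_index[OF finite_atMost ab] by (intro sum.cong) (auto simp: E)
    also have "\<dots> = iota 1 $$ (a, b)"
      using ab by (simp add: iota_one)
    finally show "iota (\<Sum>i\<le>d. E i) $$ (a, b) = iota 1 $$ (a, b)" .
  qed simp_all
  then show "(\<Sum>i\<le>d. E i) = 1" by (simp add: iota_inject)
next
  fix i assume i: "i \<le> d"
  have "iota (X * E i) = iota (scaleA (\<theta> i) (E i))"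
    using i by (auto simp: iota_mult iota_scale X E diagonal_mult intro!: eq_matI)
      (auto simp: diagonal_def)
  then show "X * E i = scaleA (\<theta> i) (E i)" by (simp add: iota_inject)
next
  fix i Y assume i: "i \<le> d"
  let ?D = "diagonal (Suc d) (\<lambda>a. if a = i then 1 else 0) :: 'k mat"
  have "tr d iota (Y * E i) = (\<Sum>a\<le>d. if a = i then iota Y $$ (i, i) else 0)"
    unfolding tr_def iota_mult E[OF i]
    by (intro sum.cong) (auto simp: mult_diagonal_index simp del: index_mult_mat(1))
  also have "\<dots> = iota Y $$ (i, i)" using i by simp
  finally have tr: "tr d iota (Y * E i) = iota Y $$ (i, i)" .
  have "iota (E i * Y * E i) = iota (scaleA (iota Y $$ (i, i)) (E i))"
    unfolding iota_mult iota_scale E[OF i]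
  proof (rule eq_matI)
    fix a b assume "a < dim_row (iota Y $$ (i, i) \<cdot>\<^sub>m ?D)" "b < dim_col (iota Y $$ (i, i) \<cdot>\<^sub>m ?D)"
    then have ab: "a < Suc d" "b < Suc d" by (simp_all add: diagonal_def)
    have "(?D * iota Y * ?D) $$ (a, b)
        = (if a = i then 1 else 0) * iota Y $$ (a, b) * (if b = i then 1 else 0)"
      using ab by (subst mult_diagonal_index)
        (auto simp: diagonal_mult_index assoc_square simp del: index_mult_mat(1))
    also have "\<dots> = (iota Y $$ (i, i) \<cdot>\<^sub>m ?D) $$ (a, b)"
      using ab i by (auto simp: diagonal_def)
    finally show "(?D * iota Y * ?D) $$ (a, b) = (iota Y $$ (i, i) \<cdot>\<^sub>m ?D) $$ (a, b)" .
  qed (simp_all add: diagonal_def)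
  then show "E i * Y * E i = scaleA (tr d iota (Y * E i)) (E i)"
    by (simp add: iota_inject tr)
qed

lemma spectral_resolution_if_idempotent_ordering:
  assumes "idempotent_ordering scaleA d iota X \<theta> E"
  shows "spectral_resolution scaleA d iota X \<theta> E"
proof -
  have bij: "bij_betw \<theta> {..d} (eigenvalues iota X)"
    and E: "\<And>i. i \<le> d \<Longrightarrow> E i = primitive_idempotent scaleA d X \<theta> i"
    using assms by (auto simp: idempotent_ordering_def)
  have inj: "inj_on \<theta> {..d}" using bij by (simp add: bij_betw_def)
  obtain S T where S: "S \<in> carrier_mat (Suc d) (Suc d)" and T: "T \<in> carrier_mat (Suc d) (Suc d)"
    and ST: "S * T = 1\<^sub>m (Suc d)" and TS: "T * S = 1\<^sub>m (Suc d)"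
    and XS: "iota X * S = S * diagonal (Suc d) \<theta>"
    using diagonalization[OF bij] .
  define rho where "rho = (\<lambda>X. T * iota X * S)"
  interpret rho: matrix_algebra scaleA d rho
    unfolding rho_def by (rule conjugate(1)[OF S T ST TS])
  have diag: "rho Y = diagonal (Suc d) f" if "iota Y * S = S * diagonal (Suc d) f" for Y f
  proof -
    have "rho Y = T * (iota Y * S)"
      using S T by (simp add: rho_def assoc_square)
    also have "\<dots> = (T * S) * diagonal (Suc d) f"
      using S T unfolding that
      by (simp add: assoc_square)
    also have "\<dots> = diagonal (Suc d) f"
      unfolding TS by (rule left_mult_one_mat[OF diagonal_carrier])
    finally show ?thesis .
  qed
  interpret R: spectral_resolution scaleA d rho X \<theta> E
    by (rule rho.spectral_resolution_of_diagonal)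
      (auto intro!: diag XS inj iota_primitive_idempotent_mult_eigenvectors[OF S XS inj] simp: E)
  have "tr d rho Y = tr d iota Y" for Y
    unfolding rho_def by (rule conjugate(2)[OF S T ST TS])
  then show ?thesis
    by unfold_locales (use R.inj R.orth R.complete R.eigen R.rank_one in auto)
qed

end

section \<open>Polynomials in an algebra element\<close>

lemma degree_prod_linear [simp]: "finite J \<Longrightarrow> degree (\<Prod>j\<in>J. [:- c j, 1 :: 'k::field:]) = card J"
  by (subst degree_prod_eq_sum_degree) auto

lemma coeff_prod_linear: "finite J \<Longrightarrow> coeff (\<Prod>j\<in>J. [:- c j, 1 :: 'k::field:]) (card J) = 1"
  using lead_coeff_prod[of "\<lambda>j. [:- c j, 1:]" J] by simp

context matrix_algebra
begin

lemma poly_at_upto: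
  assumes "degree p \<le> n"
  shows "poly_at scaleA p X = (\<Sum>k\<le>n. scaleA (coeff p k) (X ^ k))"
  unfolding poly_at_def
  by (rule sum.mono_neutral_left) (use assms in \<open>auto simp: coeff_eq_0\<close>)

lemma poly_at_0 [simp]: "poly_at scaleA 0 X = 0"
  by (simp add: poly_at_def)

lemma poly_at_1 [simp]: "poly_at scaleA 1 X = 1"
  by (simp add: poly_at_def)

lemma poly_at_pCons: "poly_at scaleA (pCons c p) X = scaleA c 1 + X * poly_at scaleA p X"
proof -
  have "poly_at scaleA (pCons c p) X = (\<Sum>k\<le>Suc (degree p). scaleA (coeff (pCons c p) k) (X ^ k))"
    by (rule poly_at_upto) (simp add: degree_pCons_le)
  also have "\<dots> = scaleA c 1 + (\<Sum>k\<le>degree p. scaleA (coeff p k) (X * X ^ k))"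
    by (subst sum.atMost_Suc_shift) simp
  finally show ?thesis
    by (simp add: poly_at_def sum_distrib_left scale_mult_right)
qed

lemma poly_at_add: "poly_at scaleA (p + q) X = poly_at scaleA p X + poly_at scaleA q X"
proof -
  let ?n = "max (degree p) (degree q)"
  have "poly_at scaleA (p + q) X = (\<Sum>k\<le>?n. scaleA (coeff (p + q) k) (X ^ k))"
    by (rule poly_at_upto) (simp add: degree_add_le_max)
  then show ?thesis
    by (simp add: poly_at_upto[of p ?n] poly_at_upto[of q ?n] scale_left_distrib sum.distrib)
qed

lemma poly_at_smult: "poly_at scaleA (Polynomial.smult c p) X = scaleA c (poly_at scaleA p X)"
  by (subst poly_at_upto[of _ "degree p"]) (simp_all add: degree_smult_le poly_at_def scale_sum_right)

lemma poly_at_mult: "poly_at scaleA (p * q) X = poly_at scaleA p X * poly_at scaleA q X"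
  by (induction p)
    (simp_all add: poly_at_pCons poly_at_add poly_at_smult distrib_right scale_mult_left mult.assoc)

end

section \<open>Rank-one idempotents acting on the irreducible module\<close>

context irreducible_module
begin

lemma act_zero_right [simp]: "act Y 0 = 0"
  using act_add_right[of Y 0 0] by simp

lemma act_zero_left [simp]: "act 0 v = 0"
  using act_add_left[of 0 0 v] by simp

lemma act_diff_right: "act Y (u - v) = act Y u - act Y v"
  using act_add_right[of Y "u - v" v] by (simp add: algebra_simps)

lemma act_sum_left: "act (\<Sum>x\<in>B. f x) v = (\<Sum>x\<in>B. act (f x) v)"
  by (induction B rule: infinite_finite_induct) (simp_all add: act_add_left)

lemma act_sum_right: "act Y (\<Sum>x\<in>B. f x) = (\<Sum>x\<in>B. act Y (f x))"
  by (induction B rule: infinite_finite_induct) (simp_all add: act_add_right)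

lemma act_linear_factor: "act (poly_at scaleA [:- c, 1:] Y) v = act Y v - scaleV c v"
  using act_add_left[of "poly_at scaleA [:- c, 1:] Y" "scaleA c 1" v]
  by (simp add: poly_at_pCons act_scale_left act_one algebra_simps)

text \<open>The orbit of \<open>v\<close> under the algebra is a nonzero submodule.\<close>

lemma cyclic:
  assumes "v \<noteq> 0"
  obtains Y where "w = act Y v"
proof -
  let ?W = "range (\<lambda>Y. act Y v)"
  have "V.subspace ?W"
  proof (rule V.subspaceI)
    show "0 \<in> ?W" by (rule range_eqI[of _ _ 0]) simp
  next
    fix x y assume "x \<in> ?W" "y \<in> ?W"
    then obtain Y Z where "x = act Y v" "y = act Z v" by auto
    then show "x + y \<in> ?W"
      by (intro range_eqI[of _ _ "Y + Z"]) (simp add: act_add_left)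
  next
    fix c x assume "x \<in> ?W"
    then obtain Y where "x = act Y v" by auto
    then show "scaleV c x \<in> ?W"
      by (intro range_eqI[of _ _ "scaleA c Y"]) (simp add: act_scale_left)
  qed
  moreover have "act Y x \<in> ?W" if "x \<in> ?W" for Y x
    using that by (auto simp flip: act_mult)
  ultimately have "?W = {0} \<or> ?W = UNIV" by (rule irreducible)
  moreover have "v \<in> ?W" by (rule range_eqI[of _ _ 1]) (simp add: act_one)
  ultimately have "w \<in> ?W" using assms by auto
  then show thesis using that by auto
qed

text \<open>If the operators \<open>Y r\<close> single out the index \<open>r = i\<close> on \<open>w\<close>, a sum with left factors \<open>Z r\<close> collapses to its
  \<open>i\<close>-th term. All sums in the theorem have this form.\<close>

lemma act_select:
  assumes "\<And>r. r \<le> d \<Longrightarrow> act (Y r) w = (if i = r then y else 0)" and "i \<le> d"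
  shows "act (scaleA c (\<Sum>r\<le>d. Z r * Y r)) w = act (Z i) (scaleV c y)"
proof -
  have "act (\<Sum>r\<le>d. Z r * Y r) w = (\<Sum>r\<le>d. if i = r then act (Z i) y else 0)"
    unfolding act_sum_left by (intro sum.cong) (auto simp: act_mult assms(1))
  then show ?thesis using assms(2) by (simp add: act_scale_left act_scale_right)
qed

end

locale module_spectral_resolution =
  irreducible_module scaleA d iota scaleV act + spectral_resolution scaleA d iota X \<theta> E
  for scaleA :: "'k::field \<Rightarrow> 'a::ring_1 \<Rightarrow> 'a" and d :: nat and iota :: "'a \<Rightarrow> 'k mat"
    and scaleV :: "'k \<Rightarrow> 'v::ab_group_add \<Rightarrow> 'v" and act :: "'a \<Rightarrow> 'v \<Rightarrow> 'v"
    and X :: 'a and \<theta> :: "nat \<Rightarrow> 'k" and E :: "nat \<Rightarrow> 'a"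
begin

lemma act_E_E: "\<lbrakk>i \<le> d; j \<le> d\<rbrakk> \<Longrightarrow> act (E i) (act (E j) v) = (if i = j then act (E i) v else 0)"
  using orth[of i j] by (simp flip: act_mult)

lemma expand: "v = (\<Sum>i\<le>d. act (E i) v)"
  by (simp flip: act_sum_left add: complete act_one)

lemma eq_0_if_components_0: "(\<And>i. i \<le> d \<Longrightarrow> act (E i) v = 0) \<Longrightarrow> v = 0"
  by (subst expand) simp

lemma act_X_E: "i \<le> d \<Longrightarrow> act X (act (E i) v) = scaleV (\<theta> i) (act (E i) v)"
  by (simp flip: act_mult act_scale_left add: eigen)

lemma act_E_X:
  assumes "i \<le> d"
  shows "act (E i) (act X v) = scaleV (\<theta> i) (act (E i) v)"
proof -
  have "act (E i) (act X v) = (\<Sum>j\<le>d. act (E i) (act X (act (E j) v)))"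
    by (subst expand[of v]) (simp add: act_sum_right)
  also have "\<dots> = (\<Sum>j\<le>d. if i = j then scaleV (\<theta> i) (act (E i) v) else 0)"
    using assms by (intro sum.cong) (auto simp: act_X_E act_scale_right act_E_E)
  finally show ?thesis using assms by simp
qed

lemma act_E_poly:
  assumes "i \<le> d"
  shows "act (E i) (act (poly_at scaleA p X) v) = scaleV (poly p (\<theta> i)) (act (E i) v)"
proof (induction p)
  case 0
  then show ?case by simp
next
  case (pCons c p)
  then show ?case
    using assms
    by (simp add: poly_at_pCons act_add_left act_scale_left act_scale_right act_one act_mult
        act_add_right act_E_X V.scale_left_distrib)
qed

lemma act_poly_eq_0:
  assumes "\<And>i. i \<le> d \<Longrightarrow> poly p (\<theta> i) = 0 \<or> act (E i) v = 0"
  shows "act (poly_at scaleA p X) v = 0"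
  by (rule eq_0_if_components_0) (use assms in \<open>auto simp: act_E_poly\<close>)

lemma act_rank_one:
  assumes "i \<le> d" "act (E i) v = v"
  shows "act (E i) (act Y v) = scaleV (tr d iota (Y * E i)) v"
proof -
  have "act (E i) (act Y v) = act (E i * Y * E i) v"
    by (simp add: act_mult assms)
  then show ?thesis
    by (simp only: rank_one[OF assms(1)] act_scale_left assms(2))
qed

text \<open>Every \<open>w\<close> is \<open>act Y v\<close> for some \<open>Y\<close>, and \<open>E i\<close> compresses \<open>Y\<close> to a scalar.\<close>

lemma one_dimensional:
  assumes "i \<le> d" "act (E i) v = v" "v \<noteq> 0"
  obtains c where "act (E i) w = scaleV c v"
proof -
  obtain Y where "w = act Y v" using cyclic[OF assms(3)] .
  then show thesis using that act_rank_one[OF assms(1,2)] by blast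
qed

text \<open>A corner \<open>E j * B * E i\<close> that is nonzero in the algebra kills no nonzero vector of the line \<open>E i V\<close>: by
  nondegeneracy of the trace some \<open>Z\<close> carries its image back to a nonzero multiple of the vector.\<close>

lemma act_corner_nonzero:
  assumes "i \<le> d" "E j * B * E i \<noteq> 0" "act (E i) v \<noteq> 0"
  shows "act (E j) (act B (act (E i) v)) \<noteq> 0"
proof
  assume zero: "act (E j) (act B (act (E i) v)) = 0"
  obtain Z where Z: "tr d iota (Z * (E j * B * E i)) \<noteq> 0"
    using tr_nondegenerate[OF assms(2)] .
  have "act (E i) (act (Z * (E j * B)) (act (E i) v)) = scaleV (tr d iota (Z * (E j * B) * E i)) (act (E i) v)"
    by (rule act_rank_one) (use assms(1) in \<open>simp_all add: act_E_E\<close>)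
  then have "scaleV (tr d iota (Z * (E j * B) * E i)) (act (E i) v) = 0"
    by (simp add: act_mult zero)
  then show False
    using Z assms(3) by (simp add: mult.assoc)
qed

end

section \<open>Tridiagonal action\<close>

locale tridiagonal_action = module_spectral_resolution scaleA d iota scaleV act X \<theta> E
  for scaleA :: "'k::field \<Rightarrow> 'a::ring_1 \<Rightarrow> 'a" and d :: nat and iota :: "'a \<Rightarrow> 'k mat"
    and scaleV :: "'k \<Rightarrow> 'v::ab_group_add \<Rightarrow> 'v" and act :: "'a \<Rightarrow> 'v \<Rightarrow> 'v"
    and X :: 'a and \<theta> :: "nat \<Rightarrow> 'k" and E :: "nat \<Rightarrow> 'a" +
  fixes B :: 'a
  assumes far: "\<lbrakk>i \<le> d; j \<le> d; \<bar>int i - int j\<bar> > 1\<rbrakk> \<Longrightarrow> E i * B * E j = 0"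
    and near: "\<lbrakk>i \<le> d; j \<le> d; \<bar>int i - int j\<bar> = 1\<rbrakk> \<Longrightarrow> E i * B * E j \<noteq> 0"
begin

lemma reversed: "tridiagonal_action scaleA d iota scaleV act X (\<lambda>i. \<theta> (d - i)) (\<lambda>i. E (d - i)) B"
proof unfold_locales
  have "x = y" if "x \<le> d" "y \<le> d" "\<theta> (d - x) = \<theta> (d - y)" for x y
    using inj_onD[OF inj that(3)] that(1,2) by simp
  then show "inj_on (\<lambda>i. \<theta> (d - i)) {..d}"
    by (simp add: inj_on_def)
  show "(\<Sum>i\<le>d. E (d - i)) = 1"
    using complete sum.atLeastAtMost_rev[of E 0 d] by (simp add: atLeast0AtMost)
  show "E (d - i) * E (d - j) = (if i = j then E (d - i) else 0)" if "i \<le> d" "j \<le> d" for i j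
    using orth[of "d - i" "d - j"] that by auto
  show "X * E (d - i) = scaleA (\<theta> (d - i)) (E (d - i))" if "i \<le> d" for i
    by (rule eigen) simp
  show "E (d - i) * Y * E (d - i) = scaleA (tr d iota (Y * E (d - i))) (E (d - i))" if "i \<le> d" for i Y
    by (rule rank_one) simp
  show "E (d - i) * B * E (d - j) = 0" if "i \<le> d" "j \<le> d" "\<bar>int i - int j\<bar> > 1" for i j
    by (rule far) (use that in linarith)+
  show "E (d - i) * B * E (d - j) \<noteq> 0" if "i \<le> d" "j \<le> d" "\<bar>int i - int j\<bar> = 1" for i j
    by (rule near) (use that in linarith)+
qed

text \<open>Only the components of \<open>v\<close> adjacent to \<open>i\<close> contribute to the \<open>i\<close>-th component of \<open>act B v\<close>.\<close>

lemma act_E_B_single: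
  assumes "i \<le> d" "k \<le> d" and "\<And>j. \<lbrakk>j \<le> d; j \<noteq> k; \<bar>int i - int j\<bar> \<le> 1\<rbrakk> \<Longrightarrow> act (E j) v = 0"
  shows "act (E i) (act B v) = act (E i) (act B (act (E k) v))"
proof -
  have *: "act (E i) (act B (act (E j) v)) = 0" if "j \<le> d" "j \<noteq> k" for j
  proof (cases "\<bar>int i - int j\<bar> \<le> 1")
    case True
    then show ?thesis using assms(3)[OF that True] by simp
  next
    case False
    then have "E i * B * E j = 0" using far assms(1) that by simp
    then show ?thesis by (simp flip: act_mult add: mult.assoc)
  qed
  have "act (E i) (act B v) = (\<Sum>j\<le>d. act (E i) (act B (act (E j) v)))"
    by (subst expand[of v]) (simp add: act_sum_right)
  also have "\<dots> = (\<Sum>j\<le>d. if j = k then act (E i) (act B (act (E k) v)) else 0)"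
    using * by (intro sum.cong) auto
  finally show ?thesis using assms(2) by simp
qed

lemma act_E_B_above:
  assumes "\<And>j. \<lbrakk>k < j; j \<le> d\<rbrakk> \<Longrightarrow> act (E j) v = 0" and "Suc k < i" "i \<le> d"
  shows "act (E i) (act B v) = 0"
proof -
  have "act (E i) (act B v) = act (E i) (act B (act (E i) v))"
    by (rule act_E_B_single) (use assms in auto)
  then show ?thesis using assms by simp
qed

lemma act_E_B_top:
  assumes "\<And>j. \<lbrakk>k < j; j \<le> d\<rbrakk> \<Longrightarrow> act (E j) v = 0" and "act (E k) v \<noteq> 0" "Suc k \<le> d"
  shows "act (E (Suc k)) (act B v) \<noteq> 0"
proof -
  have "act (E (Suc k)) (act B v) = act (E (Suc k)) (act B (act (E k) v))"
    by (rule act_E_B_single) (use assms in auto)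
  then show ?thesis using act_corner_nonzero[of k "Suc k" B v] near[of "Suc k" k] assms by simp
qed

text \<open>Each application of \<open>B\<close> raises the highest occupied component by at most one, and, since the
  off-diagonal corners are nonzero, by exactly one as long as the index stays within \<open>d\<close>.\<close>

lemma act_E_power_above:
  assumes "\<And>j. \<lbrakk>k < j; j \<le> d\<rbrakk> \<Longrightarrow> act (E j) v = 0" and "k + n < i" "i \<le> d"
  shows "act (E i) (act (B ^ n) v) = 0"
  using assms(2,3)
proof (induction n arbitrary: i)
  case 0
  then show ?case using assms(1) by (simp add: act_one)
next
  case (Suc n)
  have "act (E i) (act B (act (B ^ n) v)) = 0"
    by (rule act_E_B_above[of "k + n"]) (use Suc in auto)
  then show ?case by (simp add: act_mult)
qed

lemma act_E_power_top:
  assumes "\<And>j. \<lbrakk>k < j; j \<le> d\<rbrakk> \<Longrightarrow> act (E j) v = 0" and "act (E k) v \<noteq> 0" "k + n \<le> d"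
  shows "act (E (k + n)) (act (B ^ n) v) \<noteq> 0"
  using assms(3)
proof (induction n)
  case 0
  then show ?case using assms(2) by (simp add: act_one)
next
  case (Suc n)
  have "act (E (Suc (k + n))) (act B (act (B ^ n) v)) \<noteq> 0"
    by (rule act_E_B_top) (use Suc act_E_power_above[OF assms(1)] in auto)
  then show ?case by (simp add: act_mult)
qed

text \<open>Only the top-degree term of a polynomial can reach the component \<open>k + n\<close>.\<close>

lemma act_E_poly_above:
  assumes "\<And>j. \<lbrakk>k < j; j \<le> d\<rbrakk> \<Longrightarrow> act (E j) v = 0" and "degree p \<le> n" "k + n \<le> d"
  shows "act (E (k + n)) (act (poly_at scaleA p B) v)
       = scaleV (coeff p n) (act (E (k + n)) (act (B ^ n) v))"
proof -
  have "act (E (k + n)) (act (poly_at scaleA p B) v)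
      = (\<Sum>m\<le>n. scaleV (coeff p m) (act (E (k + n)) (act (B ^ m) v)))"
    by (simp add: poly_at_upto[OF assms(2)] act_sum_left act_sum_right act_scale_left act_scale_right)
  also have "\<dots> = (\<Sum>m\<le>n. if m = n then scaleV (coeff p n) (act (E (k + n)) (act (B ^ n) v)) else 0)"
    using act_E_power_above[OF assms(1)] assms(3) by (intro sum.cong) auto
  finally show ?thesis by simp
qed

end

section \<open>The invariant bilinear form\<close>

locale invariant_form = irreducible_module scaleA d iota scaleV act
  for scaleA :: "'k::field \<Rightarrow> 'a::ring_1 \<Rightarrow> 'a" and d :: nat and iota :: "'a \<Rightarrow> 'k mat"
    and scaleV :: "'k \<Rightarrow> 'v::ab_group_add \<Rightarrow> 'v" and act :: "'a \<Rightarrow> 'v \<Rightarrow> 'v" +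
  fixes dag :: "'a \<Rightarrow> 'a" and form :: "'v \<Rightarrow> 'v \<Rightarrow> 'k"
  assumes bilinear: "bilinear_form scaleV form"
    and form_nonzero: "\<exists>u v. form u v \<noteq> 0"
    and adjoint: "form (act X u) v = form u (act (dag X) v)"
begin

lemma
  shows form_scale_right: "form u (scaleV c v) = c * form u v"
    and form_sum_right: "form u (\<Sum>x\<in>B. f x) = (\<Sum>x\<in>B. form u (f x))"
    and form_zero_right [simp]: "form u 0 = 0"
proof -
  interpret linear: Vector_Spaces.linear scaleV "(*)" "\<lambda>v. form u v"
    using bilinear by (simp add: bilinear_form_def)
  show "form u (scaleV c v) = c * form u v" by (rule linear.scale)
  show "form u (\<Sum>x\<in>B. f x) = (\<Sum>x\<in>B. form u (f x))" by (rule linear.sum)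
  show "form u 0 = 0" by (rule linear.zero)
qed

lemma
  shows form_add_left: "form (u + w) v = form u v + form w v"
    and form_scale_left: "form (scaleV c u) v = c * form u v"
    and form_sum_left: "form (\<Sum>x\<in>B. f x) v = (\<Sum>x\<in>B. form (f x) v)"
    and form_zero_left [simp]: "form 0 v = 0"
proof -
  interpret linear: Vector_Spaces.linear scaleV "(*)" "\<lambda>u. form u v"
    using bilinear by (simp add: bilinear_form_def)
  show "form (u + w) v = form u v + form w v" by (rule linear.add)
  show "form (scaleV c u) v = c * form u v" by (rule linear.scale)
  show "form (\<Sum>x\<in>B. f x) v = (\<Sum>x\<in>B. form (f x) v)" by (rule linear.sum)
  show "form 0 v = 0" by (rule linear.zero)
qed

text \<open>The left radical is a submodule, and it is not everything.\<close>

lemma form_nondegenerate: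
  assumes "u \<noteq> 0"
  obtains v where "form u v \<noteq> 0"
proof -
  let ?W = "{u. \<forall>v. form u v = 0}"
  have "V.subspace ?W"
    by (rule V.subspaceI) (auto simp: form_add_left form_scale_left)
  moreover have "act X w \<in> ?W" if "w \<in> ?W" for X w
    using that by (simp add: adjoint)
  ultimately have "?W = {0} \<or> ?W = UNIV" by (rule irreducible)
  moreover have "?W \<noteq> UNIV" using form_nonzero by auto
  ultimately show thesis using assms that by blast
qed

end

locale self_adjoint_resolution =
  module_spectral_resolution scaleA d iota scaleV act X \<theta> E +
  invariant_form scaleA d iota scaleV act dag form
  for scaleA :: "'k::field \<Rightarrow> 'a::ring_1 \<Rightarrow> 'a" and d :: nat and iota :: "'a \<Rightarrow> 'k mat"
    and scaleV :: "'k \<Rightarrow> 'v::ab_group_add \<Rightarrow> 'v" and act :: "'a \<Rightarrow> 'v \<Rightarrow> 'v"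
    and X :: 'a and \<theta> :: "nat \<Rightarrow> 'k" and E :: "nat \<Rightarrow> 'a"
    and dag :: "'a \<Rightarrow> 'a" and form :: "'v \<Rightarrow> 'v \<Rightarrow> 'k" +
  assumes dag_X: "dag X = X"
begin

lemma form_E_E:
  assumes "i \<le> d" "j \<le> d" "i \<noteq> j"
  shows "form (act (E i) u) (act (E j) v) = 0"
proof -
  have "\<theta> i * form (act (E i) u) (act (E j) v) = form (act X (act (E i) u)) (act (E j) v)"
    by (simp add: act_X_E assms form_scale_left)
  also have "\<dots> = form (act (E i) u) (act X (act (E j) v))"
    by (simp only: adjoint dag_X)
  also have "\<dots> = \<theta> j * form (act (E i) u) (act (E j) v)"
    by (simp add: act_X_E assms form_scale_right)
  finally show ?thesis
    using inj_onD[OF inj, of i j] assms by auto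
qed

lemma form_E_left:
  assumes "i \<le> d"
  shows "form (act (E i) u) v = form (act (E i) u) (act (E i) v)"
proof -
  have "form (act (E i) u) v = (\<Sum>j\<le>d. form (act (E i) u) (act (E j) v))"
    by (subst expand[of v]) (rule form_sum_right)
  also have "\<dots> = (\<Sum>j\<le>d. if j = i then form (act (E i) u) (act (E i) v) else 0)"
    using assms by (intro sum.cong) (auto simp: form_E_E)
  finally show ?thesis using assms by simp
qed

lemma form_E_right:
  assumes "i \<le> d"
  shows "form u (act (E i) v) = form (act (E i) u) (act (E i) v)"
proof -
  have "form u (act (E i) v) = (\<Sum>j\<le>d. form (act (E j) u) (act (E i) v))"
    by (subst expand[of u]) (rule form_sum_left)
  also have "\<dots> = (\<Sum>j\<le>d. if j = i then form (act (E i) u) (act (E i) v) else 0)"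
    using assms by (intro sum.cong) (auto simp: form_E_E)
  finally show ?thesis using assms by simp
qed

text \<open>Pairing with an eigenvector \<open>w\<close> sees only the component in the line spanned by \<open>w\<close>; an isotropic \<open>w\<close>
  would therefore lie in the radical.\<close>

lemma form_anisotropic:
  assumes "i \<le> d" "act (E i) w = w" "w \<noteq> 0"
  shows "form w w \<noteq> 0"
proof
  assume zero: "form w w = 0"
  have "form w v = 0" for v
  proof -
    obtain c where "act (E i) v = scaleV c w"
      using one_dimensional[OF assms] .
    then show ?thesis
      using form_E_left[OF assms(1), of w v] zero by (simp add: assms form_scale_right)
  qed
  then show False using form_nondegenerate[OF assms(3)] by blast
qed

lemma projection:
  assumes "i \<le> d" "act (E i) w = w" "w \<noteq> 0"
  shows "act (E i) v = scaleV (form w v / form w w) w"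
proof -
  obtain c where c: "act (E i) v = scaleV c w"
    using one_dimensional[OF assms] .
  have "form w v = c * form w w"
    using form_E_left[OF assms(1), of w v] by (simp add: assms c form_scale_right)
  then show ?thesis
    using c form_anisotropic[OF assms] by simp
qed

lemma form_nonzero_if_component_nonzero:
  assumes "i \<le> d" "act (E i) w = w" "w \<noteq> 0" "act (E i) v \<noteq> 0"
  shows "form w v \<noteq> 0"
  using projection[OF assms(1-3), of v] assms(4) by auto

end

section \<open>The split basis\<close>

locale leonard_action =
  R: tridiagonal_action scaleA d iota scaleV act A \<theta> E As +
  S: tridiagonal_action scaleA d iota scaleV act As \<theta>s Es A
  for scaleA :: "'k::field \<Rightarrow> 'a::ring_1 \<Rightarrow> 'a" and d :: nat and iota :: "'a \<Rightarrow> 'k mat"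
    and scaleV :: "'k \<Rightarrow> 'v::ab_group_add \<Rightarrow> 'v" and act :: "'a \<Rightarrow> 'v \<Rightarrow> 'v"
    and A :: 'a and \<theta> :: "nat \<Rightarrow> 'k" and E :: "nat \<Rightarrow> 'a"
    and As :: 'a and \<theta>s :: "nat \<Rightarrow> 'k" and Es :: "nat \<Rightarrow> 'a"
begin

text \<open>The subspaces \<open>E\<^sub>m V + \<dots> + E\<^sub>d V\<close> and \<open>Es\<^sub>0 V + \<dots> + Es\<^sub>m\<^sub>-\<^sub>1 V\<close> meet only in zero. If \<open>w\<close> is a nonzero common vector
  with highest \<open>Es\<close>-component \<open>k < m\<close>, the product of the \<open>A - \<theta> j\<close> over \<open>m \<le> j \<le> d\<close> annihilates it, while
  its degree \<open>d + 1 - m\<close> raises the nonzero component \<open>k\<close> to a nonzero component of index at most \<open>d\<close>.\<close>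

lemma eq_0_if_split_component:
  assumes "m \<le> Suc d" and E: "\<And>j. j < m \<Longrightarrow> j \<le> d \<Longrightarrow> act (E j) w = 0"
    and Es: "\<And>k. m \<le> k \<Longrightarrow> k \<le> d \<Longrightarrow> act (Es k) w = 0"
  shows "w = 0"
proof (rule ccontr)
  assume "w \<noteq> 0"
  let ?K = "{k. k \<le> d \<and> act (Es k) w \<noteq> 0}"
  have "?K \<noteq> {}" using S.eq_0_if_components_0 \<open>w \<noteq> 0\<close> by blast
  moreover have fin: "finite ?K" by simp
  ultimately have "Max ?K \<in> ?K" using Max_in by blast
  define k where "k = Max ?K"
  have k: "k \<le> d" "act (Es k) w \<noteq> 0" using \<open>Max ?K \<in> ?K\<close> by (simp_all add: k_def)
  have above: "act (Es j) w = 0" if "k < j" "j \<le> d" for j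
  proof (rule ccontr)
    assume "act (Es j) w \<noteq> 0"
    then have "j \<le> k" unfolding k_def using that by (intro Max_ge) auto
    then show False using that by simp
  qed
  have "k < m" using Es[of k] k by (meson not_le)
  define p where "p = (\<Prod>j\<in>{m..d}. [:- \<theta> j, 1:])"
  let ?n = "card {m..d}"
  have n: "k + ?n \<le> d" using \<open>k < m\<close> k assms(1) by auto
  have "act (poly_at scaleA p A) w = 0"
  proof (rule R.act_poly_eq_0)
    fix j assume "j \<le> d"
    then show "poly p (\<theta> j) = 0 \<or> act (E j) w = 0"
      using E[of j] by (cases "j < m") (auto simp: p_def poly_prod)
  qed
  moreover have "act (Es (k + ?n)) (act (poly_at scaleA p A) w)
      = act (Es (k + ?n)) (act (A ^ ?n) w)"
    using S.act_E_poly_above[OF above, where p = p and n = ?n] n coeff_prod_linear[of "{m..d}" \<theta>]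
    by (simp add: p_def)
  ultimately show False
    using S.act_E_power_top[OF above k(2) n] by simp
qed

end

lemma poly_tau: "poly (tau \<theta> i) x = (\<Prod>j<i. x - \<theta> j)"
  by (simp add: tau_def poly_prod)

lemma poly_tau_eq_0: "j < i \<Longrightarrow> poly (tau \<theta> i) (\<theta> j) = 0"
  by (auto simp: poly_tau)

lemma tau_Suc: "tau \<theta> (Suc i) = tau \<theta> i * [:- \<theta> i, 1:]"
  by (simp add: tau_def)

lemma degree_tau: "degree (tau \<theta> i) = i"
  by (simp add: tau_def)

lemma coeff_tau: "coeff (tau \<theta> i) i = 1"
  using coeff_prod_linear[of "{..<i}" \<theta>] by (simp add: tau_def)

lemma eta_eq_tau: "eta d \<theta> = tau (\<lambda>i. \<theta> (d - i))"
  by (simp add: eta_def tau_def fun_eq_iff)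

locale leonard_split = leonard_action scaleA d iota scaleV act A \<theta> E As \<theta>s Es
  for scaleA :: "'k::field \<Rightarrow> 'a::ring_1 \<Rightarrow> 'a" and d :: nat and iota :: "'a \<Rightarrow> 'k mat"
    and scaleV :: "'k \<Rightarrow> 'v::ab_group_add \<Rightarrow> 'v" and act :: "'a \<Rightarrow> 'v \<Rightarrow> 'v"
    and A :: 'a and \<theta> :: "nat \<Rightarrow> 'k" and E :: "nat \<Rightarrow> 'a"
    and As :: 'a and \<theta>s :: "nat \<Rightarrow> 'k" and Es :: "nat \<Rightarrow> 'a" +
  fixes vphi :: "nat \<Rightarrow> 'k" and \<xi> :: 'v
  assumes vphi: "i \<in> {1..d} \<Longrightarrow> vphi i = (\<theta>s 0 - \<theta>s i) *
        (tr d iota (poly_at scaleA (tau \<theta> i) A * Es 0) /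
         tr d iota (poly_at scaleA (tau \<theta> (i - 1)) A * Es 0))"
    and Es_\<xi>: "act (Es 0) \<xi> = \<xi>" and \<xi>_nonzero: "\<xi> \<noteq> 0"
begin

text \<open>The split basis \<open>\<tau>\<^sub>i(A) \<xi>\<close>: on it \<open>A\<close> is lower bidiagonal by construction, and \<open>As\<close> turns out to be upper
  bidiagonal.\<close>

definition split_vec :: "nat \<Rightarrow> 'v" where
  "split_vec i = act (poly_at scaleA (tau \<theta> i) A) \<xi>"

lemma Es_\<xi>_above: "0 < j \<Longrightarrow> j \<le> d \<Longrightarrow> act (Es j) \<xi> = 0"
  using S.act_E_E[of j 0 \<xi>] Es_\<xi> by simp

lemma E_u: "j \<le> d \<Longrightarrow> act (E j) (split_vec i) = scaleV (poly (tau \<theta> i) (\<theta> j)) (act (E j) \<xi>)"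
  by (simp add: split_vec_def R.act_E_poly)

lemma E_u_below: "j < i \<Longrightarrow> j \<le> d \<Longrightarrow> act (E j) (split_vec i) = 0"
  by (simp add: E_u poly_tau_eq_0)

lemma Es_u_above:
  assumes "i < j" "j \<le> d"
  shows "act (Es j) (split_vec i) = 0"
proof -
  have "act (Es (0 + j)) (split_vec i) = scaleV (coeff (tau \<theta> i) j) (act (Es (0 + j)) (act (A ^ j) \<xi>))"
    unfolding split_vec_def
    by (rule S.act_E_poly_above) (use assms in \<open>auto simp: Es_\<xi>_above degree_tau\<close>)
  then show ?thesis using assms by (simp add: coeff_eq_0 degree_tau)
qed

text \<open>The product of the \<open>A - \<theta> l\<close> over \<open>l \<noteq> j\<close> maps \<open>\<xi>\<close> into \<open>E j V\<close>; being monic of degree \<open>d\<close>, it gives \<open>\<xi>\<close> a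
  nonzero component in \<open>Es d V\<close>. So \<open>\<xi>\<close> has a nonzero component in \<open>E j V\<close>.\<close>

lemma E_\<xi>_nonzero:
  assumes "j \<le> d"
  shows "act (E j) \<xi> \<noteq> 0"
proof
  assume zero: "act (E j) \<xi> = 0"
  let ?J = "{..d} - {j}"
  define p where "p = (\<Prod>l\<in>?J. [:- \<theta> l, 1:])"
  have card: "card ?J = d" using assms by simp
  have "act (poly_at scaleA p A) \<xi> = 0"
    by (rule R.act_poly_eq_0) (use zero in \<open>auto simp: p_def poly_prod\<close>)
  moreover have "act (Es (0 + d)) (act (poly_at scaleA p A) \<xi>)
      = scaleV (coeff p d) (act (Es (0 + d)) (act (A ^ d) \<xi>))"
    by (rule S.act_E_poly_above) (use card in \<open>auto simp: p_def Es_\<xi>_above\<close>)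
  moreover have "coeff p d = 1"
    using coeff_prod_linear[of ?J \<theta>] card by (simp add: p_def)
  ultimately show False
    using S.act_E_power_top[of 0 \<xi> d] Es_\<xi>_above Es_\<xi> \<xi>_nonzero by simp
qed

lemma E_u_diag_nonzero:
  assumes "i \<le> d"
  shows "act (E i) (split_vec i) \<noteq> 0"
proof -
  have "\<theta> i - \<theta> j \<noteq> 0" if "j < i" for j
    using inj_onD[OF R.inj, of i j] assms that by auto
  then show ?thesis
    using assms by (auto simp: E_u poly_tau E_\<xi>_nonzero)
qed

text \<open>The vector \<open>w = (As - \<theta>s (i+1)) u (i+1)\<close> has no \<open>E j\<close>-component for \<open>j < i\<close> and no \<open>Es k\<close>-component for
  \<open>k > i\<close>, where \<open>u i\<close> stands for \<open>split_vec i\<close>. Subtracting the multiple \<open>c\<close> of \<open>u i\<close> with the same \<open>E i\<close>-component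
  leaves a vector that vanishes by \<open>eq_0_if_split_component\<close>. The coefficient \<open>c\<close> is nonzero because the
  corner \<open>E i * As * E (i+1)\<close> is.\<close>

lemma As_u_split:
  assumes "Suc i \<le> d"
  obtains c where "c \<noteq> 0" "act As (split_vec (Suc i)) = scaleV (\<theta>s (Suc i)) (split_vec (Suc i)) + scaleV c (split_vec i)"
proof -
  define w where "w = act As (split_vec (Suc i)) - scaleV (\<theta>s (Suc i)) (split_vec (Suc i))"
  have E_w: "act (E j) w = act (E j) (act As (act (E (Suc i)) (split_vec (Suc i))))" if "j \<le> i" for j
  proof -
    have "act (E j) (act As (split_vec (Suc i))) = act (E j) (act As (act (E (Suc i)) (split_vec (Suc i))))"
      by (rule R.act_E_B_single) (use that assms in \<open>auto intro!: E_u_below\<close>)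
    then show ?thesis
      using that assms E_u_below[of j "Suc i"]
      by (simp add: w_def R.act_diff_right R.act_scale_right)
  qed
  have E_w_below: "act (E j) w = 0" if "j < i" for j
    using R.far[of j "Suc i"] that assms by (simp add: E_w mult.assoc flip: R.act_mult)
  have Es_w: "act (Es k) w = 0" if "i < k" "k \<le> d" for k
    using Es_u_above[of "Suc i" k] that
    by (cases "k = Suc i") (simp_all add: w_def R.act_diff_right R.act_scale_right S.act_E_X)
  obtain c where c: "act (E i) w = scaleV c (act (E i) (split_vec i))"
    by (rule R.one_dimensional[of i "act (E i) (split_vec i)" w])
      (use assms E_u_diag_nonzero[of i] in \<open>auto simp: R.act_E_E\<close>)
  have "w - scaleV c (split_vec i) = 0"
  proof (rule eq_0_if_split_component[of "Suc i"])
    show "act (E j) (w - scaleV c (split_vec i)) = 0" if "j < Suc i" "j \<le> d" for j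
      using that c E_w_below[of j] E_u_below[of j i]
      by (cases "j = i") (auto simp: R.act_diff_right R.act_scale_right)
    show "act (Es k) (w - scaleV c (split_vec i)) = 0" if "Suc i \<le> k" "k \<le> d" for k
      using that Es_w[of k] Es_u_above[of i k] by (simp add: R.act_diff_right R.act_scale_right)
  qed (use assms in simp)
  then have "act As (split_vec (Suc i)) = scaleV (\<theta>s (Suc i)) (split_vec (Suc i)) + scaleV c (split_vec i)"
    by (simp add: w_def algebra_simps)
  moreover have "act (E i) w \<noteq> 0"
    using R.act_corner_nonzero[OF assms R.near[of i "Suc i"]] E_u_diag_nonzero[OF assms] assms
    by (simp add: E_w)
  then have "c \<noteq> 0" using c by auto
  ultimately show thesis using that by blast
qed

text \<open>The coordinate of \<open>Es 0 (split_vec i)\<close> with respect to \<open>\<xi>\<close>.\<close>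

definition split_tr :: "nat \<Rightarrow> 'k" where
  "split_tr i = tr d iota (poly_at scaleA (tau \<theta> i) A * Es 0)"

lemma Es_u_0: "act (Es 0) (split_vec i) = scaleV (split_tr i) \<xi>"
  unfolding split_vec_def split_tr_def by (rule S.act_rank_one) (simp_all add: Es_\<xi>)

text \<open>Compare the \<open>Es 0\<close>-components of both sides. This identifies the coefficient \<open>c\<close> with the quotient of
  traces that defines the first split sequence, and shows inductively that the traces are nonzero.\<close>

lemma split_tr_recursion:
  assumes "act As (split_vec (Suc i)) = scaleV (\<theta>s (Suc i)) (split_vec (Suc i)) + scaleV c (split_vec i)"
  shows "(\<theta>s 0 - \<theta>s (Suc i)) * split_tr (Suc i) = c * split_tr i"
proof -
  have "act (Es 0) (act As (split_vec (Suc i))) = scaleV (\<theta>s 0 * split_tr (Suc i)) \<xi>"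
    by (simp add: S.act_E_X Es_u_0)
  moreover have "act (Es 0) (act As (split_vec (Suc i))) = scaleV (\<theta>s (Suc i) * split_tr (Suc i) + c * split_tr i) \<xi>"
    by (simp add: assms R.act_add_right R.act_scale_right Es_u_0 R.V.scale_left_distrib)
  ultimately have "\<theta>s 0 * split_tr (Suc i) = \<theta>s (Suc i) * split_tr (Suc i) + c * split_tr i"
    using \<xi>_nonzero by simp
  then show ?thesis by (simp add: algebra_simps)
qed

lemma split_tr_nonzero: "i \<le> d \<Longrightarrow> split_tr i \<noteq> 0"
proof (induction i)
  case 0
  have "split_vec 0 = \<xi>" by (simp add: split_vec_def tau_def R.act_one)
  then show ?case using Es_u_0[of 0] Es_\<xi> \<xi>_nonzero by auto
next
  case (Suc i)
  obtain c where "c \<noteq> 0" "act As (split_vec (Suc i)) = scaleV (\<theta>s (Suc i)) (split_vec (Suc i)) + scaleV c (split_vec i)"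
    using As_u_split[OF Suc.prems] .
  then show ?case using split_tr_recursion[of i c] Suc by auto
qed

lemma
  assumes "Suc i \<le> d"
  shows As_u: "act As (split_vec (Suc i)) = scaleV (\<theta>s (Suc i)) (split_vec (Suc i)) + scaleV (vphi (Suc i)) (split_vec i)"
    and vphi_nonzero: "vphi (Suc i) \<noteq> 0"
proof -
  obtain c where c: "c \<noteq> 0" "act As (split_vec (Suc i)) = scaleV (\<theta>s (Suc i)) (split_vec (Suc i)) + scaleV c (split_vec i)"
    using As_u_split[OF assms] .
  have "vphi (Suc i) = (\<theta>s 0 - \<theta>s (Suc i)) * split_tr (Suc i) / split_tr i"
    using vphi[of "Suc i"] assms by (simp add: split_tr_def)
  also have "\<dots> = c"
    using split_tr_recursion[OF c(2)] split_tr_nonzero[of i] assms by simp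
  finally show "vphi (Suc i) \<noteq> 0"
    "act As (split_vec (Suc i)) = scaleV (\<theta>s (Suc i)) (split_vec (Suc i)) + scaleV (vphi (Suc i)) (split_vec i)"
    using c by simp_all
qed

lemma As_u_0: "act As (split_vec 0) = scaleV (\<theta>s 0) (split_vec 0)"
  using S.act_X_E[of 0 \<xi>] by (simp add: split_vec_def tau_def R.act_one Es_\<xi>)

lemma prod_vphi_nonzero: "r \<le> d \<Longrightarrow> (\<Prod>k=1..r. vphi k) \<noteq> 0"
  by (induction r) (auto simp: vphi_nonzero)

text \<open>The new factor \<open>As - \<theta>s r\<close> of \<open>\<tau>\<^sup>*\<^sub>r\<^sub>+\<^sub>1(As)\<close> sends \<open>split_vec i\<close> to a multiple \<open>\<theta>s i - \<theta>s r\<close> of itself plus \<open>vphi i\<close>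
  times its predecessor. By induction the first part contributes only for \<open>i = r\<close>, where its coefficient is
  zero, and the second only for \<open>i = r + 1\<close>.\<close>

lemma E_0_taus_u:
  assumes "r \<le> d" "i \<le> d"
  shows "act (E 0) (act (poly_at scaleA (tau \<theta>s r) As) (split_vec i))
       = (if i = r then scaleV (\<Prod>k=1..r. vphi k) (act (E 0) \<xi>) else 0)"
  using assms
proof (induction r arbitrary: i)
  case 0
  show ?case
  proof (cases "i = 0")
    case True
    then show ?thesis by (simp add: split_vec_def tau_def R.act_one)
  next
    case False
    then show ?thesis using E_u_below[of 0 i] by (simp add: tau_def R.act_one)
  qed
next
  case (Suc r)
  let ?P = "poly_at scaleA (tau \<theta>s r) As"
  have step: "act (poly_at scaleA (tau \<theta>s (Suc r)) As) v
      = act ?P (act As v - scaleV (\<theta>s r) v)" for v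
    by (simp only: tau_Suc R.poly_at_mult R.act_mult R.act_linear_factor)
  show ?case
  proof (cases i)
    case 0
    have "act (E 0) (act (poly_at scaleA (tau \<theta>s (Suc r)) As) (split_vec 0))
        = scaleV (\<theta>s 0 - \<theta>s r) (act (E 0) (act ?P (split_vec 0)))"
      by (simp add: step As_u_0 R.act_scale_right R.act_diff_right R.V.scale_left_diff_distrib)
    also have "\<dots> = 0" using Suc by auto
    finally show ?thesis using 0 by simp
  next
    case i: (Suc i')
    have "act As (split_vec i) - scaleV (\<theta>s r) (split_vec i)
        = scaleV (\<theta>s i - \<theta>s r) (split_vec i) + scaleV (vphi i) (split_vec i')"
      using i \<open>i \<le> d\<close> As_u[of i'] by (simp add: R.V.scale_left_diff_distrib algebra_simps)
    then have "act (E 0) (act (poly_at scaleA (tau \<theta>s (Suc r)) As) (split_vec i))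
        = scaleV (\<theta>s i - \<theta>s r) (act (E 0) (act ?P (split_vec i)))
          + scaleV (vphi i) (act (E 0) (act ?P (split_vec i')))"
      by (simp add: step R.act_add_right R.act_scale_right)
    also have "scaleV (\<theta>s i - \<theta>s r) (act (E 0) (act ?P (split_vec i))) = 0"
      using Suc.IH[of i] Suc.prems by auto
    finally show ?thesis
      using Suc.IH[of i'] Suc.prems i by (simp add: mult.commute)
  qed
qed

text \<open>For \<open>i > r\<close> the polynomial \<open>\<eta>\<^sub>d\<^sub>-\<^sub>r \<tau>\<^sub>i\<close> vanishes at all eigenvalues of \<open>A\<close>; for \<open>i < r\<close> its degree is too small to
  reach \<open>Es d V\<close> from \<open>Es 0 V\<close>; for \<open>i = r\<close> it is monic of degree \<open>d\<close>.
  Writing the value with \<open>A ^ d\<close> makes it the same vector for both orders of the eigenvalues of \<open>A\<close>.\<close>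

lemma Es_d_eta_u:
  assumes "r \<le> d" "i \<le> d"
  shows "act (Es d) (act (poly_at scaleA (eta d \<theta> (d - r)) A) (split_vec i))
       = (if i = r then act (Es d) (act (A ^ d) \<xi>) else 0)"
proof -
  let ?p = "eta d \<theta> (d - r) * tau \<theta> i"
  have eq: "act (poly_at scaleA (eta d \<theta> (d - r)) A) (split_vec i) = act (poly_at scaleA ?p A) \<xi>"
    by (simp add: split_vec_def R.poly_at_mult R.act_mult)
  show ?thesis
  proof (cases "r < i")
    case True
    have "act (poly_at scaleA ?p A) \<xi> = 0"
    proof (rule R.act_poly_eq_0)
      fix j assume j: "j \<le> d"
      show "poly ?p (\<theta> j) = 0 \<or> act (E j) \<xi> = 0"
      proof (cases "j < i")
        case True
        then show ?thesis by (simp add: poly_tau_eq_0)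
      next
        case False
        then have "d - j < d - r" using \<open>r < i\<close> j by linarith
        from poly_tau_eq_0[OF this, of "\<lambda>i. \<theta> (d - i)"] show ?thesis
          using j by (simp add: eta_eq_tau)
      qed
    qed
    then show ?thesis using True eq by simp
  next
    case False
    have deg: "degree (eta d \<theta> (d - r)) = d - r"
      by (simp add: eta_eq_tau degree_tau)
    have le: "degree ?p \<le> d"
      using degree_mult_le[of "eta d \<theta> (d - r)" "tau \<theta> i"] assms False
      by (simp add: deg degree_tau)
    have "act (Es (0 + d)) (act (poly_at scaleA ?p A) \<xi>)
        = scaleV (coeff ?p d) (act (Es (0 + d)) (act (A ^ d) \<xi>))"
      by (rule S.act_E_poly_above) (use le in \<open>auto simp: Es_\<xi>_above\<close>)
    moreover have "coeff ?p d = (if i = r then 1 else 0)"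
    proof (cases "i = r")
      case True
      then show ?thesis
        using coeff_mult_degree_sum[of "eta d \<theta> (d - r)" "tau \<theta> i"] assms
        by (simp add: deg degree_tau coeff_tau) (simp add: eta_eq_tau coeff_tau)
    next
      case i: False
      then have "degree ?p < d"
        using degree_mult_le[of "eta d \<theta> (d - r)" "tau \<theta> i"] assms False
        by (simp add: deg degree_tau)
      then show ?thesis using i by (simp add: coeff_eq_0)
    qed
    ultimately show ?thesis by (simp add: eq)
  qed
qed

text \<open>Up to the factor \<open>\<tau>\<^sup>*\<^sub>d(\<theta>s d)\<close>, the idempotent \<open>Es d\<close> is \<open>\<tau>\<^sup>*\<^sub>d(As)\<close>, so this is the case \<open>r = i = d\<close> of \<open>E_0_taus_u\<close>.\<close>

lemma E_0_Es_d_power: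
  "scaleV (poly (tau \<theta>s d) (\<theta>s d)) (act (E 0) (act (Es d) (act (A ^ d) \<xi>)))
   = scaleV (\<Prod>k=1..d. vphi k) (act (E 0) \<xi>)"
proof -
  have "act (poly_at scaleA (tau \<theta>s d) As) (split_vec d) - scaleV (poly (tau \<theta>s d) (\<theta>s d)) (act (Es d) (split_vec d)) = 0"
  proof (rule S.eq_0_if_components_0)
    fix i assume i: "i \<le> d"
    show "act (Es i) (act (poly_at scaleA (tau \<theta>s d) As) (split_vec d)
        - scaleV (poly (tau \<theta>s d) (\<theta>s d)) (act (Es d) (split_vec d))) = 0"
      using i poly_tau_eq_0[of i d \<theta>s]
      by (cases "i = d") (auto simp: R.act_diff_right R.act_scale_right S.act_E_poly S.act_E_E)
  qed
  then have "act (E 0) (act (poly_at scaleA (tau \<theta>s d) As) (split_vec d))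
      = scaleV (poly (tau \<theta>s d) (\<theta>s d)) (act (E 0) (act (Es d) (split_vec d)))"
    by (simp add: R.act_scale_right)
  moreover have "act (Es d) (split_vec d) = act (Es d) (act (A ^ d) \<xi>)"
    using Es_d_eta_u[of d d] by (simp add: eta_def R.act_one)
  ultimately show ?thesis
    using E_0_taus_u[of d d] by simp
qed

end

section \<open>Normalization and the summation identities\<close>

locale leonard_form =
  leonard_split scaleA d iota scaleV act A \<theta> E As \<theta>s Es vphi \<xi> +
  R: self_adjoint_resolution scaleA d iota scaleV act A \<theta> E dag form +
  S: self_adjoint_resolution scaleA d iota scaleV act As \<theta>s Es dag form
  for scaleA :: "'k::field \<Rightarrow> 'a::ring_1 \<Rightarrow> 'a" and d :: nat and iota :: "'a \<Rightarrow> 'k mat"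
    and scaleV :: "'k \<Rightarrow> 'v::ab_group_add \<Rightarrow> 'v" and act :: "'a \<Rightarrow> 'v \<Rightarrow> 'v"
    and A :: 'a and \<theta> :: "nat \<Rightarrow> 'k" and E :: "nat \<Rightarrow> 'a"
    and As :: 'a and \<theta>s :: "nat \<Rightarrow> 'k" and Es :: "nat \<Rightarrow> 'a"
    and vphi :: "nat \<Rightarrow> 'k" and \<xi> :: 'v
    and dag :: "'a \<Rightarrow> 'a" and form :: "'v \<Rightarrow> 'v \<Rightarrow> 'k"
begin

lemma form_\<xi>_nonzero:
  assumes "act (E 0) \<xi>0 = \<xi>0" "\<xi>0 \<noteq> 0"
  shows "form \<xi>0 \<xi> \<noteq> 0"
  using R.form_nonzero_if_component_nonzero[of 0] assms E_\<xi>_nonzero[of 0] by simp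

lemma act_Es_0_E_0: "act (Es 0) (act (E 0) \<xi>) = scaleV (tr d iota (E 0 * Es 0)) \<xi>"
  by (rule S.act_rank_one) (simp_all add: Es_\<xi>)

text \<open>The trace times \<open>form \<xi> \<xi>\<close> equals \<open>form w w\<close> for the nonzero vector \<open>w = E 0 \<xi>\<close>, and eigenvectors of \<open>A\<close> are
  not isotropic.\<close>

lemma tr_E_0_Es_0_nonzero: "tr d iota (E 0 * Es 0) \<noteq> 0"
proof -
  have "form \<xi> (act (E 0) \<xi>) = form (act (E 0) \<xi>) (act (E 0) \<xi>)"
    by (rule R.form_E_right) simp
  also have "\<dots> \<noteq> 0"
    by (rule R.form_anisotropic[of 0]) (simp_all add: R.act_E_E E_\<xi>_nonzero)
  finally have "form \<xi> (act (E 0) \<xi>) \<noteq> 0" .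
  moreover have "form \<xi> (act (E 0) \<xi>) = form \<xi> (act (Es 0) (act (E 0) \<xi>))"
    using S.form_E_left[of 0 \<xi>] by (simp add: Es_\<xi>)
  ultimately show ?thesis
    by (auto simp: act_Es_0_E_0 R.form_scale_right)
qed

lemma act_E_0_Es_d_power:
  assumes "act (E 0) \<xi>0 = \<xi>0" "\<xi>0 \<noteq> 0"
  shows "scaleV (poly (tau \<theta>s d) (\<theta>s d) / (\<Prod>k=1..d. vphi k) * (form \<xi>0 \<xi>0 / form \<xi>0 \<xi>))
           (act (E 0) (act (Es d) (act (A ^ d) \<xi>))) = \<xi>0"
proof -
  have "act (E 0) \<xi> = scaleV (form \<xi>0 \<xi> / form \<xi>0 \<xi>0) \<xi>0"
    using R.projection[of 0 \<xi>0 \<xi>] assms by simp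
  then have "scaleV (poly (tau \<theta>s d) (\<theta>s d)) (act (E 0) (act (Es d) (act (A ^ d) \<xi>)))
      = scaleV ((\<Prod>k=1..d. vphi k) * (form \<xi>0 \<xi> / form \<xi>0 \<xi>0)) \<xi>0"
    by (simp only: E_0_Es_d_power R.V.scale_scale)
  then have "scaleV (form \<xi>0 \<xi>0 / form \<xi>0 \<xi> / (\<Prod>k=1..d. vphi k))
        (scaleV (poly (tau \<theta>s d) (\<theta>s d)) (act (E 0) (act (Es d) (act (A ^ d) \<xi>))))
      = scaleV (form \<xi>0 \<xi>0 / form \<xi>0 \<xi> / (\<Prod>k=1..d. vphi k))
          (scaleV ((\<Prod>k=1..d. vphi k) * (form \<xi>0 \<xi> / form \<xi>0 \<xi>0)) \<xi>0)"
    by (rule arg_cong)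
  moreover have "form \<xi>0 \<xi>0 \<noteq> 0" using R.form_anisotropic[of 0] assms by simp
  ultimately show ?thesis
    using prod_vphi_nonzero[of d] form_\<xi>_nonzero[OF assms] by (simp add: field_simps)
qed

text \<open>Both sides lie on the line \<open>Es d V\<close>; the scalar is found by pairing \<open>E_0_Es_d_power\<close> with \<open>\<xi>0\<close>.\<close>

lemma act_Es_d_power:
  assumes "act (E 0) \<xi>0 = \<xi>0" "\<xi>0 \<noteq> 0" and "act (Es d) \<xi>sd = \<xi>sd" "\<xi>sd \<noteq> 0"
  shows "scaleV (poly (tau \<theta>s d) (\<theta>s d) / (\<Prod>k=1..d. vphi k) * (form \<xi>0 \<xi>sd / form \<xi>0 \<xi>))
           (act (Es d) (act (A ^ d) \<xi>)) = \<xi>sd"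
proof -
  let ?P = "poly (tau \<theta>s d) (\<theta>s d)" and ?p = "\<Prod>k=1..d. vphi k"
  obtain c where c: "act (Es d) (act (A ^ d) \<xi>) = scaleV c \<xi>sd"
    using S.one_dimensional[of d \<xi>sd] assms(3,4) by blast
  have form_E: "form \<xi>0 (act (E 0) v) = form \<xi>0 v" for v
    using R.form_E_left[of 0 \<xi>0 v] assms(1) by simp
  have "form \<xi>0 (scaleV ?P (act (E 0) (act (Es d) (act (A ^ d) \<xi>))))
      = form \<xi>0 (scaleV ?p (act (E 0) \<xi>))"
    by (simp only: E_0_Es_d_power)
  then have "?P * (c * form \<xi>0 \<xi>sd) = ?p * form \<xi>0 \<xi>"
    by (simp only: R.form_scale_right form_E c)
  then show ?thesis
    using prod_vphi_nonzero[of d] form_\<xi>_nonzero[OF assms(1,2)] by (simp add: c field_simps)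
qed

lemma sum_Es_0_E_0_taus:
  assumes "i \<le> d"
  shows "act (scaleA (1 / tr d iota (E 0 * Es 0))
          (\<Sum>r\<le>d. scaleA (1 / (\<Prod>k=1..r. vphi k)) (Z r * Es 0 * E 0 * poly_at scaleA (tau \<theta>s r) As)))
      (act (poly_at scaleA (tau \<theta> i) A) \<xi>) = act (Z i) \<xi>"
proof -
  define Y where "Y r = scaleA (1 / (\<Prod>k=1..r. vphi k)) (Es 0 * E 0 * poly_at scaleA (tau \<theta>s r) As)" for r
  have "act (Y r) (split_vec i) = (if i = r then scaleV (tr d iota (E 0 * Es 0)) \<xi> else 0)" if "r \<le> d" for r
    using that assms prod_vphi_nonzero[of r]
    by (simp add: Y_def R.act_scale_left R.act_mult E_0_taus_u R.act_scale_right act_Es_0_E_0)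
  from R.act_select[OF this assms, where Z = Z and c = "1 / tr d iota (E 0 * Es 0)"]
  show ?thesis
    using tr_E_0_Es_0_nonzero by (simp add: Y_def R.scale_mult_right mult.assoc split_vec_def)
qed

lemma sum_Es_d_eta:
  assumes "i \<le> d" and "act (E 0) \<xi>0 = \<xi>0" "\<xi>0 \<noteq> 0" and "act (Es d) \<xi>sd = \<xi>sd" "\<xi>sd \<noteq> 0"
  shows "act (scaleA (poly (tau \<theta>s d) (\<theta>s d) / (\<Prod>k=1..d. vphi k) * (form \<xi>0 \<xi>sd / form \<xi>0 \<xi>))
          (\<Sum>r\<le>d. Z r * Es d * poly_at scaleA (eta d \<theta> (d - r)) A))
      (act (poly_at scaleA (tau \<theta> i) A) \<xi>) = act (Z i) \<xi>sd"
proof -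
  define Y where "Y r = Es d * poly_at scaleA (eta d \<theta> (d - r)) A" for r
  have "act (Y r) (split_vec i) = (if i = r then act (Es d) (act (A ^ d) \<xi>) else 0)" if "r \<le> d" for r
    using that assms(1) by (simp add: Y_def R.act_mult Es_d_eta_u)
  from R.act_select[OF this assms(1), where Z = Z] show ?thesis
    by (simp only: Y_def mult.assoc split_vec_def act_Es_d_power[OF assms(2-)] flip: split_vec_def)
qed

lemma sum_E_0_taus:
  assumes "i \<le> d" and "act (E 0) \<xi>0 = \<xi>0" "\<xi>0 \<noteq> 0"
  shows "act (scaleA (form \<xi>0 \<xi>0 / form \<xi>0 \<xi>)
          (\<Sum>r\<le>d. scaleA (1 / (\<Prod>k=1..r. vphi k)) (Z r * E 0 * poly_at scaleA (tau \<theta>s r) As)))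
      (act (poly_at scaleA (tau \<theta> i) A) \<xi>) = act (Z i) \<xi>0"
proof -
  define Y where "Y r = scaleA (1 / (\<Prod>k=1..r. vphi k)) (E 0 * poly_at scaleA (tau \<theta>s r) As)" for r
  have "act (Y r) (split_vec i) = (if i = r then act (E 0) \<xi> else 0)" if "r \<le> d" for r
    using that assms(1) prod_vphi_nonzero[of r]
    by (simp add: Y_def R.act_scale_left R.act_mult E_0_taus_u)
  moreover have "scaleV (form \<xi>0 \<xi>0 / form \<xi>0 \<xi>) (act (E 0) \<xi>) = \<xi>0"
    using R.projection[of 0 \<xi>0 \<xi>] R.form_anisotropic[of 0 \<xi>0] form_\<xi>_nonzero[of \<xi>0] assms by simp
  ultimately show ?thesis
    using R.act_select[of Y "split_vec i" i "act (E 0) \<xi>" "form \<xi>0 \<xi>0 / form \<xi>0 \<xi>" Z] assms(1)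
    by (simp add: Y_def R.scale_mult_right mult.assoc split_vec_def)
qed

text \<open>The theorem uses this with \<open>F = E d\<close>, where the normalization of \<open>\<zeta>\<close> comes from the same Leonard system with
  the eigenvalues of \<open>A\<close> in reverse order.\<close>

lemma sum_F_Es_d_eta:
  assumes "i \<le> d" and "scaleV c (act F (act (Es d) (act (A ^ d) \<xi>))) = \<zeta>"
  shows "act (scaleA c (\<Sum>r\<le>d. Z r * F * Es d * poly_at scaleA (eta d \<theta> (d - r)) A))
      (act (poly_at scaleA (tau \<theta> i) A) \<xi>) = act (Z i) \<zeta>"
proof -
  define Y where "Y r = F * Es d * poly_at scaleA (eta d \<theta> (d - r)) A" for r
  have "act (Y r) (split_vec i) = (if i = r then act F (act (Es d) (act (A ^ d) \<xi>)) else 0)" if "r \<le> d" for r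
    using that assms(1) by (simp add: Y_def R.act_mult Es_d_eta_u)
  from R.act_select[OF this assms(1), where Z = Z and c = c] show ?thesis
    by (simp add: Y_def mult.assoc split_vec_def assms(2))
qed

end

section \<open>Transition maps between bases of a Leonard system\<close>

theorem theorem14p1:
  fixes d :: nat
    and scaleA :: "'k::field \<Rightarrow> 'a::ring_1 \<Rightarrow> 'a"
    and iota :: "'a \<Rightarrow> 'k mat"
    and scaleV :: "'k \<Rightarrow> 'v::ab_group_add \<Rightarrow> 'v"
    and act :: "'a \<Rightarrow> 'v \<Rightarrow> 'v"
    and A As :: 'a
    and E Es :: "nat \<Rightarrow> 'a"
    and \<theta> \<theta>s vphi phi :: "nat \<Rightarrow> 'k"
    and dag :: "'a \<Rightarrow> 'a"
    and form :: "'v \<Rightarrow> 'v \<Rightarrow> 'k"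
    and \<xi>0 \<xi>d \<xi>s0 \<xi>sd :: 'v
  assumes "irreducible_module scaleA d iota scaleV act"
    and "leonard_system scaleA d iota A E As Es"
    and "parameter_array scaleA d iota A E As Es \<theta> \<theta>s vphi phi"
    and "antiautomorphism scaleA dag" and "dag A = A" and "dag As = As"
    and "bilinear_form scaleV form" and "\<exists>u v. form u v \<noteq> 0"
    and "\<And>X u v. form (act X u) v = form u (act (dag X) v)"
    and "\<xi>0 \<in> range (act (E 0))" and "\<xi>0 \<noteq> 0"
    and "\<xi>d \<in> range (act (E d))" and "\<xi>d \<noteq> 0"
    and "\<xi>s0 \<in> range (act (Es 0))" and "\<xi>s0 \<noteq> 0"
    and "\<xi>sd \<in> range (act (Es d))" and "\<xi>sd \<noteq> 0"
  shows
    "(\<forall>X \<in> {\<lambda>i. E i,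
                \<lambda>i. E (d - i),
                \<lambda>i. poly_at scaleA (tau \<theta> i) A,
                \<lambda>i. poly_at scaleA (tau \<theta> (d - i)) A,
                \<lambda>i. poly_at scaleA (eta d \<theta> i) A,
                \<lambda>i. poly_at scaleA (eta d \<theta> (d - i)) A}.
        \<forall>i\<le>d.
          act (scaleA (1 / tr d iota (E 0 * Es 0))
                 (\<Sum>r\<le>d. scaleA (1 / (\<Prod>k=1..r. vphi k)) (X r * Es 0 * E 0 * poly_at scaleA (tau \<theta>s r) As)))
              (act (poly_at scaleA (tau \<theta> i) A) \<xi>s0) = act (X i) \<xi>s0 \<and>
          act (scaleA (poly (tau \<theta>s d) (\<theta>s d) / (\<Prod>k=1..d. vphi k) * (form \<xi>0 \<xi>sd / form \<xi>0 \<xi>s0))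
                 (\<Sum>r\<le>d. X r * Es d * poly_at scaleA (eta d \<theta> (d - r)) A))
              (act (poly_at scaleA (tau \<theta> i) A) \<xi>s0) = act (X i) \<xi>sd \<and>
          act (scaleA (1 / tr d iota (E 0 * Es 0))
                 (\<Sum>r\<le>d. scaleA (1 / (\<Prod>k=1..r. vphi k)) (X (d - r) * Es 0 * E 0 * poly_at scaleA (tau \<theta>s r) As)))
              (act (poly_at scaleA (tau \<theta> (d - i)) A) \<xi>s0) = act (X i) \<xi>s0 \<and>
          act (scaleA (poly (tau \<theta>s d) (\<theta>s d) / (\<Prod>k=1..d. vphi k) * (form \<xi>0 \<xi>sd / form \<xi>0 \<xi>s0))
                 (\<Sum>r\<le>d. X (d - r) * Es d * poly_at scaleA (eta d \<theta> (d - r)) A))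
              (act (poly_at scaleA (tau \<theta> (d - i)) A) \<xi>s0) = act (X i) \<xi>sd) \<and>
     (\<forall>X \<in> {\<lambda>i. Es i,
                \<lambda>i. Es (d - i),
                \<lambda>i. poly_at scaleA (tau \<theta>s i) As,
                \<lambda>i. poly_at scaleA (tau \<theta>s (d - i)) As,
                \<lambda>i. poly_at scaleA (eta d \<theta>s i) As,
                \<lambda>i. poly_at scaleA (eta d \<theta>s (d - i)) As}.
        \<forall>i\<le>d.
          act (scaleA (form \<xi>0 \<xi>0 / form \<xi>0 \<xi>s0)
                 (\<Sum>r\<le>d. scaleA (1 / (\<Prod>k=1..r. vphi k)) (X r * E 0 * poly_at scaleA (tau \<theta>s r) As)))
              (act (poly_at scaleA (tau \<theta> i) A) \<xi>s0) = act (X i) \<xi>0 \<and>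
          act (scaleA (poly (tau \<theta>s d) (\<theta>s d) / (\<Prod>k=1..d. phi k) * (form \<xi>d \<xi>d / form \<xi>d \<xi>s0))
                 (\<Sum>r\<le>d. X r * E d * Es d * poly_at scaleA (eta d \<theta> (d - r)) A))
              (act (poly_at scaleA (tau \<theta> i) A) \<xi>s0) = act (X i) \<xi>d \<and>
          act (scaleA (form \<xi>0 \<xi>0 / form \<xi>0 \<xi>s0)
                 (\<Sum>r\<le>d. scaleA (1 / (\<Prod>k=1..r. vphi k)) (X (d - r) * E 0 * poly_at scaleA (tau \<theta>s r) As)))
              (act (poly_at scaleA (tau \<theta> (d - i)) A) \<xi>s0) = act (X i) \<xi>0 \<and>
          act (scaleA (poly (tau \<theta>s d) (\<theta>s d) / (\<Prod>k=1..d. phi k) * (form \<xi>d \<xi>d / form \<xi>d \<xi>s0))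
                 (\<Sum>r\<le>d. X (d - r) * E d * Es d * poly_at scaleA (eta d \<theta> (d - r)) A))
              (act (poly_at scaleA (tau \<theta> (d - i)) A) \<xi>s0) = act (X i) \<xi>d)"
proof -
  interpret irreducible_module scaleA d iota scaleV act by fact
  have R: "spectral_resolution scaleA d iota A \<theta> E" and S: "spectral_resolution scaleA d iota As \<theta>s Es"
    using assms(3) by (auto simp: parameter_array_def intro!: spectral_resolution_if_idempotent_ordering)
  interpret R: spectral_resolution scaleA d iota A \<theta> E by (rule R)
  interpret S: spectral_resolution scaleA d iota As \<theta>s Es by (rule S)
  interpret R: tridiagonal_action scaleA d iota scaleV act A \<theta> E As
    by unfold_locales (use assms(2) in \<open>simp_all add: leonard_system_def\<close>)
  interpret S: tridiagonal_action scaleA d iota scaleV act As \<theta>s Es A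
    by unfold_locales (use assms(2) in \<open>simp_all add: leonard_system_def\<close>)
  (* Reversing the order of the E i exchanges tau with eta, and hence vphi with phi. *)
  interpret R': tridiagonal_action scaleA d iota scaleV act A "\<lambda>i. \<theta> (d - i)" "\<lambda>i. E (d - i)" As
    by (rule R.reversed)
  interpret invariant_form scaleA d iota scaleV act dag form
    by unfold_locales (use assms in auto)
  have E0: "act (E 0) \<xi>0 = \<xi>0" and Ed: "act (E d) \<xi>d = \<xi>d"
    and Es0: "act (Es 0) \<xi>s0 = \<xi>s0" and Esd: "act (Es d) \<xi>sd = \<xi>sd"
    using assms(10,12,14,16) by (auto simp: R.act_E_E S.act_E_E)
  interpret L: leonard_form scaleA d iota scaleV act A \<theta> E As \<theta>s Es vphi \<xi>s0 dag form
    by unfold_locales (use assms Es0 in \<open>auto simp: parameter_array_def\<close>)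
  interpret L': leonard_form scaleA d iota scaleV act A "\<lambda>i. \<theta> (d - i)" "\<lambda>i. E (d - i)"
    As \<theta>s Es phi \<xi>s0 dag form
    by unfold_locales (use assms Es0 in \<open>auto simp: parameter_array_def simp flip: eta_eq_tau\<close>)
  have last: "scaleV (poly (tau \<theta>s d) (\<theta>s d) / (\<Prod>k=1..d. phi k) * (form \<xi>d \<xi>d / form \<xi>d \<xi>s0))
      (act (E d) (act (Es d) (act (A ^ d) \<xi>s0))) = \<xi>d"
    using L'.act_E_0_Es_d_power[of \<xi>d] Ed assms by simp
  note identities =
    L.sum_Es_0_E_0_taus
    L.sum_Es_d_eta[OF _ E0 \<open>\<xi>0 \<noteq> 0\<close> Esd \<open>\<xi>sd \<noteq> 0\<close>]
    L.sum_E_0_taus[OF _ E0 \<open>\<xi>0 \<noteq> 0\<close>]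
    L.sum_F_Es_d_eta[OF _ last]
  (* The reversed sums are the same identities for the sequence X (d - r) at position d - i. *)
  show ?thesis
  proof (intro conjI ballI allI impI, goal_cases)
    case (3 X i)
    then show ?case using identities(1)[of "d - i" "\<lambda>r. X (d - r)"] by simp
  next
    case (4 X i)
    then show ?case using identities(2)[of "d - i" "\<lambda>r. X (d - r)"] by simp
  next
    case (7 X i)
    then show ?case using identities(3)[of "d - i" "\<lambda>r. X (d - r)"] by simp
  next
    case (8 X i)
    then show ?case using identities(4)[of "d - i" "\<lambda>r. X (d - r)"] by simp
  qed (rule identities, assumption)+
qed

end
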